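(* Let $\mathcal{A}=\mathcal{A}_1\cup\mathcal{A}_2\cup\mathcal{A}_3$ be an arrangement of $12$ lines in $\mathbb{P}^2\mathbb{C}$ defined by a $(3,4)$-net, with all intersection points double or triple points. Suppose the Latin square of the net is in the main class of $M_1$ or in the main class of $M_2$, where $$M_1=\begin{pmatrix}1&2&3&4\\2&3&4&1\\3&4&1&2\\4&1&2&3\end{pmatrix},\qquad M_2=\begin{pmatrix}1&2&3&4\\2&1&4&3\\3&4&1&2\\4&3&2&1\end{pmatrix}.$$ Then, for either main class, exactly one of the following holds. (1) All three $\mathcal{A}_i$ are of type (ii), and $\mathcal{A}$ has $16$ triple points. (2) All three $\mathcal{A}_i$ are of type (i), and $\mathcal{A}$ has $19$ triple points. (3) Exactly one $\mathcal{A}_i$ is of type (i) and the other two are of type (ii), and $\mathcal{A}$ has $17$ triple points. In particular, it never happens that exactly two of the $\mathcal{A}_i$ are of type (i). Moreover, for each fixed main class ($M_1$ or $M_2$), each of the three situations occurs. Within a given situation, any two such arrangements are lattice isomorphic. Hence the number of triple points determines $\mathcal{A}$ up to lattice isomorphism.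
   Context: A $(3,q)$-net in $\mathbb{P}^2\mathbb{C}$ is a line arrangement $\mathcal{A}$ together with a partition $\mathcal{A}=\mathcal{A}_1\sqcup\mathcal{A}_2\sqcup\mathcal{A}_3$ with $|\mathcal{A}_i|=q$ for each $i$, such that every intersection point of two lines from different classes lies on exactly one line of each class. A mixed triple point is a point lying on one line from each class; there are $q^2$ of them. The Latin square of the net is obtained as follows. Order the lines $\mathcal{A}_j=\{L^j_1,\dots,L^j_q\}$. Then the $(k,l)$ entry is the index $\alpha(k,l)$ such that $L^1_k\cap L^2_l\cap L^3_{\alpha(k,l)}\neq\emptyset$. Two Latin squares are in the same main class if one is obtained from the other by permuting rows, permuting columns, permuting symbols, and permuting the roles of rows, columns and symbols among themselves. For $q=4$ there are exactly two main classes, represented by $M_1$ and $M_2$. A class $\mathcal{A}_j$ is of type (i) if three of its lines meet at a point, and of type (ii) otherwise, in which case all intersections inside $\mathcal{A}_j$ are double points. A point is double or triple if exactly $2$ or $3$ lines of $\mathcal{A}$ pass through it. Two line arrangements are lattice isomorphic if there is a bijection between their lines preserving which subsets of lines are concurrent. *)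

theory Defs
  imports Complex_Main
begin

text \<open>Homogeneous coordinates in C^3. A line {a x + b y + c z = 0} and a point [x:y:z]
  are both represented by nonzero triples, up to nonzero scalars.\<close>

type_synonym cvec = "complex \<times> complex \<times> complex"

definition smul :: "complex \<Rightarrow> cvec \<Rightarrow> cvec" where
  "smul c v = (case v of (x, y, z) \<Rightarrow> (c * x, c * y, c * z))"

definition nonzero :: "cvec \<Rightarrow> bool" where
  "nonzero v \<longleftrightarrow> v \<noteq> (0, 0, 0)"

definition proportional :: "cvec \<Rightarrow> cvec \<Rightarrow> bool" where
  "proportional v w \<longleftrightarrow> (\<exists>c. c \<noteq> 0 \<and> w = smul c v)"

definition proj_point :: "cvec \<Rightarrow> cvec set" where
  "proj_point v = {w. proportional v w}"

definition incident :: "cvec \<Rightarrow> cvec \<Rightarrow> bool" where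
  "incident L p \<longleftrightarrow> (case L of (a, b, c) \<Rightarrow> case p of (x, y, z) \<Rightarrow> a * x + b * y + c * z = 0)"

text \<open>Lines of the arrangement are indexed by pairs (j,k), j<3 the class, k<4 the
  index within the class (0-based).\<close>
definition idx :: "(nat \<times> nat) set" where
  "idx = {(j, k). j < 3 \<and> k < 4}"

definition lines_through :: "(nat \<times> nat \<Rightarrow> cvec) \<Rightarrow> cvec \<Rightarrow> (nat \<times> nat) set" where
  "lines_through L p = {i \<in> idx. incident (L i) p}"

definition is_34_net :: "(nat \<times> nat \<Rightarrow> cvec) \<Rightarrow> bool" where
  "is_34_net L \<longleftrightarrow>
     (\<forall>i\<in>idx. nonzero (L i)) \<and>
     (\<forall>i\<in>idx. \<forall>i'\<in>idx. i \<noteq> i' \<longrightarrow> \<not> proportional (L i) (L i')) \<and>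
     (\<forall>p. nonzero p \<longrightarrow> (\<forall>j k j' k'. (j, k) \<in> idx \<and> (j', k') \<in> idx \<and> j \<noteq> j'
          \<and> incident (L (j, k)) p \<and> incident (L (j', k')) p \<longrightarrow>
          (\<forall>m<3. \<exists>!k''. k'' < 4 \<and> incident (L (m, k'')) p)))"

definition only_double_triple :: "(nat \<times> nat \<Rightarrow> cvec) \<Rightarrow> bool" where
  "only_double_triple L \<longleftrightarrow>
     (\<forall>p. nonzero p \<longrightarrow> card (lines_through L p) \<ge> 2 \<longrightarrow>
        card (lines_through L p) = 2 \<or> card (lines_through L p) = 3)"

definition triple_points :: "(nat \<times> nat \<Rightarrow> cvec) \<Rightarrow> cvec set set" where
  "triple_points L = {proj_point p | p. nonzero p \<and> card (lines_through L p) = 3}"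

definition num_triple_points :: "(nat \<times> nat \<Rightarrow> cvec) \<Rightarrow> nat" where
  "num_triple_points L = card (triple_points L)"

definition type_i :: "(nat \<times> nat \<Rightarrow> cvec) \<Rightarrow> nat \<Rightarrow> bool" where
  "type_i L j \<longleftrightarrow> (\<exists>k1 k2 k3 p. k1 < 4 \<and> k2 < 4 \<and> k3 < 4 \<and> k1 \<noteq> k2 \<and> k1 \<noteq> k3 \<and> k2 \<noteq> k3
      \<and> nonzero p \<and> incident (L (j, k1)) p \<and> incident (L (j, k2)) p \<and> incident (L (j, k3)) p)"

definition type_ii :: "(nat \<times> nat \<Rightarrow> cvec) \<Rightarrow> nat \<Rightarrow> bool" where
  "type_ii L j \<longleftrightarrow> \<not> type_i L j"

definition num_type_i :: "(nat \<times> nat \<Rightarrow> cvec) \<Rightarrow> nat" where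
  "num_type_i L = card {j. j < 3 \<and> type_i L j}"

definition latin_entry :: "(nat \<times> nat \<Rightarrow> cvec) \<Rightarrow> nat \<Rightarrow> nat \<Rightarrow> nat" where
  "latin_entry L k l = (THE m. m < 4 \<and> (\<exists>p. nonzero p \<and> incident (L (0, k)) p
        \<and> incident (L (1, l)) p \<and> incident (L (2, m)) p))"

definition square_triples :: "(nat \<Rightarrow> nat \<Rightarrow> nat) \<Rightarrow> (nat \<times> nat \<times> nat) set" where
  "square_triples M = {(k, l, M k l) | k l. k < 4 \<and> l < 4}"

definition conjugations :: "((nat \<times> nat \<times> nat) \<Rightarrow> (nat \<times> nat \<times> nat)) set" where
  "conjugations =
     {\<lambda>(a, b, c). (a, b, c), \<lambda>(a, b, c). (a, c, b), \<lambda>(a, b, c). (b, a, c),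
      \<lambda>(a, b, c). (b, c, a), \<lambda>(a, b, c). (c, a, b), \<lambda>(a, b, c). (c, b, a)}"

definition same_main_class :: "(nat \<Rightarrow> nat \<Rightarrow> nat) \<Rightarrow> (nat \<Rightarrow> nat \<Rightarrow> nat) \<Rightarrow> bool" where
  "same_main_class M N \<longleftrightarrow>
     (\<exists>f g h \<tau>. bij_betw f {0..<4} {0..<4} \<and> bij_betw g {0..<4} {0..<4} \<and>
        bij_betw h {0..<4} {0..<4} \<and> \<tau> \<in> conjugations \<and>
        square_triples N = (\<lambda>(a, b, c). (f a, g b, h c)) ` (\<tau> ` square_triples M))"

text \<open>M1 and M2 of the paper, with symbols shifted to 0..3 and 0-based indices.\<close>
definition M1 :: "nat \<Rightarrow> nat \<Rightarrow> nat" where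
  "M1 k l = [[0,1,2,3],[1,2,3,0],[2,3,0,1],[3,0,1,2]] ! k ! l"

definition M2 :: "nat \<Rightarrow> nat \<Rightarrow> nat" where
  "M2 k l = [[0,1,2,3],[1,0,3,2],[2,3,0,1],[3,2,1,0]] ! k ! l"

definition concurrent :: "(nat \<times> nat \<Rightarrow> cvec) \<Rightarrow> (nat \<times> nat) set \<Rightarrow> bool" where
  "concurrent L S \<longleftrightarrow> (\<exists>p. nonzero p \<and> (\<forall>i\<in>S. incident (L i) p))"

definition lattice_isomorphic :: "(nat \<times> nat \<Rightarrow> cvec) \<Rightarrow> (nat \<times> nat \<Rightarrow> cvec) \<Rightarrow> bool" where
  "lattice_isomorphic L L' \<longleftrightarrow>
     (\<exists>\<sigma>. bij_betw \<sigma> idx idx \<and> (\<forall>S. S \<subseteq> idx \<longrightarrow> (concurrent L S \<longleftrightarrow> concurrent L' (\<sigma> ` S))))"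

definition good_arr :: "(nat \<times> nat \<Rightarrow> cvec) \<Rightarrow> (nat \<Rightarrow> nat \<Rightarrow> nat) \<Rightarrow> bool" where
  "good_arr L M \<longleftrightarrow> is_34_net L \<and> only_double_triple L \<and> same_main_class M (latin_entry L)"

end

theory Submission
  imports Defs
begin

text \<open>
  A class of four lines with no four concurrent has at most one internal triple point, so there are
  16 triple points plus one for each class of type (i). Such a class is determined by the line left
  out of its triple. Suppose two classes are of type (i), and put the two centres at infinity: the
  six lines through them form a 3 by 3 grid, on which the lines of the third class are determined
  by the Latin square, and three of them turn out to be concurrent. So the third class is of
  type (i) too, and its left-out line is determined by the other two. Both Latin squares are tables
  of abelian groups of order 4. Translations and permutations of the classes are symmetries of the
  relation \<open>a + b + c = 0\<close>, and they move the left-out lines of two classes to any prescribed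
  position. Hence the number of type (i) classes determines the set of all concurrent triples up
  to relabelling.
\<close>

section \<open>Lines and points in homogeneous coordinates\<close>

definition dot :: "cvec \<Rightarrow> cvec \<Rightarrow> complex" where
  "dot u p = (case u of (a, b, c) \<Rightarrow> case p of (x, y, z) \<Rightarrow> a * x + b * y + c * z)"

definition cross :: "cvec \<Rightarrow> cvec \<Rightarrow> cvec" where
  "cross u v = (case u of (a, b, c) \<Rightarrow> case v of (x, y, z) \<Rightarrow>
     (b * z - c * y, c * x - a * z, a * y - b * x))"

definition det3 :: "cvec \<Rightarrow> cvec \<Rightarrow> cvec \<Rightarrow> complex" where
  "det3 u v w = dot w (cross u v)"

lemma incident_iff_dot: "incident u p \<longleftrightarrow> dot u p = 0"
  by (simp add: incident_def dot_def split: prod.split)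

lemma nonzero_cross:
  assumes "nonzero u" "nonzero v" "\<not> proportional u v"
  shows "nonzero (cross u v)"
proof (rule ccontr)
  assume "\<not> nonzero (cross u v)"
  moreover obtain a b c where u: "u = (a, b, c)" by (cases u)
  moreover obtain x y z where v: "v = (x, y, z)" by (cases v)
  ultimately have eqs: "b * z = c * y" "c * x = a * z" "a * y = b * x"
    by (auto simp: nonzero_def cross_def)
  have no: "k = 0 \<or> \<not> (x = k * a \<and> y = k * b \<and> z = k * c)" for k
    using assms(3) by (auto simp: proportional_def smul_def u v)
  have nz: "a \<noteq> 0 \<or> b \<noteq> 0 \<or> c \<noteq> 0" "x \<noteq> 0 \<or> y \<noteq> 0 \<or> z \<noteq> 0"
    using assms by (auto simp: nonzero_def u v)
  consider "a \<noteq> 0" | "b \<noteq> 0" | "c \<noteq> 0" using nz by blast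
  then show False
  proof cases
    case 1
    then show False using no[of "x / a"] eqs nz by (auto simp: field_simps)
  next
    case 2
    then show False using no[of "y / b"] eqs nz by (auto simp: field_simps)
  next
    case 3
    then show False using no[of "z / c"] eqs nz by (auto simp: field_simps)
  qed
qed

lemma dot_cross [simp]: "dot u (cross u v) = 0" "dot v (cross u v) = 0"
  by (cases u; cases v; simp add: dot_def cross_def algebra_simps)+

text \<open>The identity (u x v) x p = (u . p) v - (v . p) u makes the second cross product
  vanish.\<close>

lemma proportional_cross:
  assumes "nonzero (cross u v)" "nonzero p" "dot u p = 0" "dot v p = 0"
  shows "proportional (cross u v) p"
proof (rule ccontr)
  assume "\<not> proportional (cross u v) p"
  then have "nonzero (cross (cross u v) p)"
    using assms nonzero_cross by blast
  moreover obtain a b c where u: "u = (a, b, c)" by (cases u)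
  moreover obtain a' b' c' where v: "v = (a', b', c')" by (cases v)
  moreover obtain x y z where p: "p = (x, y, z)" by (cases p)
  have e: "a * x + b * y + c * z = 0" "a' * x + b' * y + c' * z = 0"
    using assms(3,4) by (auto simp: dot_def u v p)
  have "cross (cross u v) p = (0, 0, 0)"
    unfolding u v p cross_def using e by (simp, algebra)
  ultimately show False by (simp add: nonzero_def)
qed

lemma proportional_dot:
  assumes "proportional p q"
  shows "dot u p = 0 \<longleftrightarrow> dot u q = 0"
proof -
  obtain c where "c \<noteq> 0" "q = smul c p" using assms by (auto simp: proportional_def)
  moreover have "dot u (smul c p) = c * dot u p"
    by (cases u; cases p) (simp add: smul_def dot_def algebra_simps)
  ultimately show ?thesis by simp
qed

lemma proportional_sym: "proportional u v \<Longrightarrow> proportional v u"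
  unfolding proportional_def
  by (elim exE conjE, rule_tac x="inverse c" in exI) (cases u; simp add: smul_def)

lemma proportional_trans: "proportional u v \<Longrightarrow> proportional v w \<Longrightarrow> proportional u w"
  unfolding proportional_def
  by (elim exE conjE, rule_tac x="ca * c" in exI) (cases u; simp add: smul_def)

lemma proportional_refl: "proportional u u"
  unfolding proportional_def by (rule exI[of _ 1]) (cases u; simp add: smul_def)

lemma proj_point_eq_iff: "proj_point p = proj_point q \<longleftrightarrow> proportional p q"
  unfolding proj_point_def
  using proportional_refl proportional_sym proportional_trans by blast

lemma concurrent_iff_det3:
  assumes "nonzero (cross u v)"
  shows "(\<exists>p. nonzero p \<and> dot u p = 0 \<and> dot v p = 0 \<and> dot w p = 0) \<longleftrightarrow> det3 u v w = 0"
  unfolding det3_def using assms proportional_cross proportional_dot dot_cross by blast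

section \<open>The 3 by 3 grid spanned by two pencils\<close>

definition frame_coords :: "cvec \<Rightarrow> cvec \<Rightarrow> cvec \<Rightarrow> cvec \<Rightarrow> cvec" where
  "frame_coords p q r u = (dot u p, dot u q, dot u r)"

text \<open>The matrix of three lines is multiplied by the matrix of three points. For independent
  points, concurrency can therefore be tested in frame coordinates.\<close>

lemma det3_frame_coords:
  "det3 (frame_coords p q r u) (frame_coords p q r v) (frame_coords p q r w)
     = det3 u v w * det3 p q r"
  by (cases p; cases q; cases r; cases u; cases v; cases w)
    (simp add: det3_def frame_coords_def dot_def cross_def algebra_simps)

lemma det3_coords:
  "det3 (a, b, c) (a', b', c') (x, y, z) =
     x * (b * c' - c * b') + y * (c * a' - a * c') + z * (a * b' - b * a')"
  by (simp add: det3_def dot_def cross_def)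

text \<open>Together with any line \<open>w\<close> that misses \<open>r\<close>, the lines
  \<open>u\<close> and \<open>v\<close> have a triangular matrix of frame coordinates with nonzero
  diagonal.\<close>

lemma frame_independent:
  assumes "nonzero r" "dot u p \<noteq> 0" "dot u q = 0" "dot u r = 0" "dot v q \<noteq> 0" "dot v r = 0"
  shows "det3 p q r \<noteq> 0"
proof -
  obtain x y z where r: "r = (x, y, z)" by (cases r)
  have "\<exists>w. dot w r \<noteq> 0"
  proof -
    have "x \<noteq> 0 \<or> y \<noteq> 0 \<or> z \<noteq> 0" using assms(1) by (auto simp: r nonzero_def)
    moreover have "dot (1,0,0) r = x" "dot (0,1,0) r = y" "dot (0,0,1) r = z"
      by (simp_all add: dot_def r)
    ultimately show ?thesis by metis
  qed
  then obtain w where "dot w r \<noteq> 0" by blast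
  then have "det3 (frame_coords p q r u) (frame_coords p q r v) (frame_coords p q r w) \<noteq> 0"
    using assms by (simp add: frame_coords_def det3_coords)
  then show ?thesis by (auto simp: det3_frame_coords)
qed

text \<open>
  Frame: \<open>Q\<close> and \<open>P\<close> are the centres of the pencils \<open>B\<close> and \<open>A\<close>, and \<open>X = A 2 \<inter> B 2\<close>. So the
  \<open>A i\<close> are vertical, the \<open>B i\<close> are horizontal lines, and the \<open>C i\<close> are read off the grid.
\<close>
lemma two_pencils_cyclic:
  fixes A B C :: "nat \<Rightarrow> cvec"
  assumes X: "nonzero X" "dot (A 2) X = 0" "dot (B 2) X = 0"
    and pencils: "\<forall>i\<in>{1,2,3}. dot (A i) P = 0" "\<forall>i\<in>{1,2,3}. dot (B i) Q = 0"
    and nz: "\<forall>i\<in>{1,2,3}. dot (A i) Q \<noteq> 0" "\<forall>i\<in>{1,2,3}. dot (B i) P \<noteq> 0"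
      "\<forall>i\<in>{1,3}. dot (A i) X \<noteq> 0" "\<forall>i\<in>{1,3}. dot (B i) X \<noteq> 0"
    and inc: "det3 (A 1) (B 3) (C 0) = 0" "det3 (A 2) (B 2) (C 0) = 0" "det3 (A 3) (B 1) (C 0) = 0"
      "det3 (A 1) (B 2) (C 1) = 0" "det3 (A 2) (B 1) (C 1) = 0"
      "det3 (A 2) (B 3) (C 3) = 0" "det3 (A 3) (B 2) (C 3) = 0"
  shows "det3 (C 0) (C 1) (C 3) = 0"
proof -
  let ?f = "frame_coords Q P X"
  have frame: "det3 Q P X \<noteq> 0"
    using frame_independent[of X "A 2" Q P "B 2"] X pencils nz by auto
  have tr: "det3 (?f u) (?f v) (?f w) = 0 \<longleftrightarrow> det3 u v w = 0" for u v w
    using frame by (simp add: det3_frame_coords)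
  \<comment> \<open>In the chart of points x Q + y P + X, the lines \<open>A 2\<close> and
    \<open>B 2\<close> are the axes. For i = 1, 3 the values \<open>p i\<close> and
    \<open>q i\<close> are minus the reciprocals of the positions of the other grid lines.\<close>
  define p q where "p i = dot (A i) Q / dot (A i) X" and "q i = dot (B i) P / dot (B i) X" for i
  define c1 c2 x1 y1 z1 x3 y3 z3 where "c1 = dot (C 0) Q" and "c2 = dot (C 0) P"
    and "x1 = dot (C 1) Q" and "y1 = dot (C 1) P" and "z1 = dot (C 1) X"
    and "x3 = dot (C 3) Q" and "y3 = dot (C 3) P" and "z3 = dot (C 3) X"
  note d = frame_coords_def det3_coords pencils nz X p_def q_def c1_def c2_def
    x1_def y1_def z1_def x3_def y3_def z3_def
  have c3: "dot (C 0) X = 0"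
    using inc(2)[THEN tr[THEN iffD2]] by (simp add: d)
  have e: "c2 * p 1 + c1 * q 3 = 0" "c2 * p 3 + c1 * q 1 = 0"
    using inc(1,3)[THEN tr[THEN iffD2]] by (simp_all add: d c3 field_simps del: One_nat_def, algebra+)
  \<comment> \<open>\<open>C 1\<close> and \<open>C 3\<close> meet both axes in grid points, so
    their intercepts are known.\<close>
  have "x1 = p 1 * z1" "y1 = q 1 * z1" "x3 = p 3 * z3" "y3 = q 3 * z3"
    using inc(4-7)[THEN tr[THEN iffD2]] by (simp_all add: d field_simps del: One_nat_def)
  then have "c1 * (y1 * z3 - z1 * y3) - c2 * (x1 * z3 - z1 * x3) = 0"
    using e by algebra
  then have "det3 (?f (C 0)) (?f (C 1)) (?f (C 3)) = 0"
    by (simp add: frame_coords_def det3_coords c3 c1_def c2_def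
    x1_def y1_def z1_def x3_def y3_def z3_def algebra_simps)
  then show ?thesis by (simp only: tr)
qed

text \<open>The common point is c2 Q + c1 P on the line joining the two centres: the harmonic
  conjugate, with respect to Q and P, of the point where \<open>C 0\<close> meets that line.\<close>

lemma two_pencils_klein:
  fixes A B C :: "nat \<Rightarrow> cvec"
  assumes X: "nonzero X" "dot (A 2) X = 0" "dot (B 2) X = 0"
    and pencils: "\<forall>i\<in>{1,2,3}. dot (A i) P = 0" "\<forall>i\<in>{1,2,3}. dot (B i) Q = 0"
    and nz: "\<forall>i\<in>{1,2,3}. dot (A i) Q \<noteq> 0" "\<forall>i\<in>{1,2,3}. dot (B i) P \<noteq> 0"
      "\<forall>i\<in>{1,3}. dot (A i) X \<noteq> 0" "\<forall>i\<in>{1,3}. dot (B i) X \<noteq> 0"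
      "dot (C 0) P \<noteq> 0" "det3 (A 1) (A 3) (B 1) \<noteq> 0"
    and inc: "det3 (A 1) (B 1) (C 0) = 0" "det3 (A 2) (B 2) (C 0) = 0" "det3 (A 3) (B 3) (C 0) = 0"
      "det3 (A 1) (B 2) (C 3) = 0" "det3 (A 2) (B 1) (C 3) = 0"
      "det3 (A 2) (B 3) (C 1) = 0" "det3 (A 3) (B 2) (C 1) = 0"
      "det3 (A 1) (B 3) (C 2) = 0" "det3 (A 3) (B 1) (C 2) = 0"
  shows "det3 (C 1) (C 2) (C 3) = 0"
proof -
  let ?f = "frame_coords Q P X"
  have frame: "det3 Q P X \<noteq> 0"
    using frame_independent[of X "A 2" Q P "B 2"] X pencils nz by auto
  have tr: "det3 (?f u) (?f v) (?f w) = 0 \<longleftrightarrow> det3 u v w = 0" for u v w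
    using frame by (simp add: det3_frame_coords)
  define p q where "p i = dot (A i) Q / dot (A i) X" and "q i = dot (B i) P / dot (B i) X" for i
  \<comment> \<open>Minus the positions of the grid lines. The reciprocals suit \<open>C 1\<close>
    and \<open>C 3\<close>, whose intercepts are grid points; \<open>C 2\<close> meets the axes
    outside the 3 by 3 grid and needs the positions themselves.\<close>
  define s t where "s i = dot (A i) X / dot (A i) Q" and "t i = dot (B i) X / dot (B i) P" for i
  define c1 c2 where "c1 = dot (C 0) Q" and "c2 = dot (C 0) P"
  define x y z where "x i = dot (C i) Q" and "y i = dot (C i) P" and "z i = dot (C i) X" for i
  note d = frame_coords_def det3_coords pencils nz X p_def q_def s_def t_def c1_def c2_def
    x_def y_def z_def
  have c3: "dot (C 0) X = 0"
    using inc(2)[THEN tr[THEN iffD2]] by (simp add: d)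
  have c2: "c2 \<noteq> 0" by (simp add: d)
  have e: "c2 * p 1 + c1 * q 1 = 0" "c2 * p 3 + c1 * q 3 = 0"
    using inc(1,3)[THEN tr[THEN iffD2]] by (simp_all add: d c3 field_simps del: One_nat_def, algebra+)
  have e': "c2 * t 1 + c1 * s 1 = 0" "c2 * t 3 + c1 * s 3 = 0"
    using inc(1,3)[THEN tr[THEN iffD2]] by (simp_all add: d c3 field_simps del: One_nat_def, algebra+)
  have "x 3 = p 1 * z 3" "y 3 = q 1 * z 3" "x 1 = p 3 * z 1" "y 1 = q 3 * z 1"
    using inc(4-7)[THEN tr[THEN iffD2]] by (simp_all add: d field_simps del: One_nat_def)
  then have k13: "c2 * x 3 + c1 * y 3 = 0" "c2 * x 1 + c1 * y 1 = 0"
    using e by algebra+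
  have "z 2 = t 3 * y 2 + s 1 * x 2" "z 2 = t 1 * y 2 + s 3 * x 2"
    using inc(8,9)[THEN tr[THEN iffD2]] by (simp_all add: d field_simps del: One_nat_def)
  \<comment> \<open>The difference of the two incidences, with \<open>t\<close> eliminated by
    \<open>e'\<close>. The first factor is nonzero because \<open>A 1\<close> and \<open>A 3\<close>
    are different lines of the pencil.\<close>
  then have "(s 1 - s 3) * (c2 * x 2 + c1 * y 2) = 0"
    using e' by algebra
  moreover have "s 1 \<noteq> s 3"
    using nz(6) tr[of "A 1" "A 3" "B 1"] by (simp add: frame_coords_def det3_coords pencils nz(1-5) s_def field_simps)
  ultimately have k2: "c2 * x 2 + c1 * y 2 = 0" by simp
  \<comment> \<open>The nonzero vector (c2, c1, 0) lies on all three lines. As a polynomial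
    consequence of this, only c2 times the determinant is seen to vanish, so c2 is cancelled
    afterwards.\<close>
  have "c2 * (x 3 * (y 1 * z 2 - z 1 * y 2) + y 3 * (z 1 * x 2 - x 1 * z 2)
      + z 3 * (x 1 * y 2 - y 1 * x 2)) = 0"
    using k13 k2 by algebra
  then have "det3 (?f (C 1)) (?f (C 2)) (?f (C 3)) = 0"
    using c2 by (simp add: frame_coords_def det3_coords x_def y_def z_def)
  then show ?thesis by (simp only: tr)
qed

section \<open>Concurrent triples of a net\<close>

declare split_paired_All [simp del] split_paired_Ex [simp del]

lemma finite_idx [simp]: "finite idx"
  by (rule finite_subset[of _ "{..<3} \<times> {..<4}"]) (auto simp: idx_def)

lemma in_idx [simp]: "(j, k) \<in> idx \<longleftrightarrow> j < 3 \<and> k < 4"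
  by (simp add: idx_def)

definition class_minus :: "nat \<Rightarrow> nat \<Rightarrow> (nat \<times> nat) set" where
  "class_minus j e = {j} \<times> ({..<4} - {e})"

lemma class_minus_subset: "j < 3 \<Longrightarrow> class_minus j e \<subseteq> idx"
  by (auto simp: class_minus_def)

lemma card_class_minus: "e < 4 \<Longrightarrow> card (class_minus j e) = 3"
  by (simp add: class_minus_def card_cartesian_product_singleton)

lemma class_minus_inject:
  assumes "e < 4" "e' < 4"
  shows "class_minus j e = class_minus j' e' \<longleftrightarrow> j = j' \<and> e = e'"
proof
  assume *: "class_minus j e = class_minus j' e'"
  define x :: nat where "x = (if e = 0 then 1 else 0)"
  have "(j, x) \<in> class_minus j e" by (auto simp: class_minus_def x_def)
  then have "j = j'" unfolding * by (simp add: class_minus_def)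
  moreover have "e = e'"
    using assms * by (auto simp: class_minus_def set_eq_iff)
  ultimately show "j = j' \<and> e = e'" by simp
qed simp

definition transversal :: "nat \<Rightarrow> nat \<Rightarrow> nat \<Rightarrow> (nat \<times> nat) set" where
  "transversal a b c = {(0, a), (1, b), (2, c)}"

lemma transversal_inject:
  "transversal a b c = transversal a' b' c' \<longleftrightarrow> a = a' \<and> b = b' \<and> c = c'"
proof
  assume *: "transversal a b c = transversal a' b' c'"
  have "(0, a) \<in> transversal a b c" "(1, b) \<in> transversal a b c" "(2, c) \<in> transversal a b c"
    by (simp_all add: transversal_def)
  then show "a = a' \<and> b = b' \<and> c = c'"
    unfolding * by (simp add: transversal_def)
qed simp

lemma transversal_subset: "a < 4 \<Longrightarrow> b < 4 \<Longrightarrow> c < 4 \<Longrightarrow> transversal a b c \<subseteq> idx"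
  by (simp add: transversal_def)

lemma card_transversal: "card (transversal a b c) = 3"
  by (simp add: transversal_def)

lemma transversal_neq_class_minus: "transversal a b c \<noteq> class_minus j e"
proof
  assume "transversal a b c = class_minus j e"
  then have "(0, a) \<in> class_minus j e" "(1, b) \<in> class_minus j e"
    by (auto simp: transversal_def)
  then show False by (simp add: class_minus_def)
qed

text \<open>Index sets instead of points: by \<open>concurrent_iff\<close> they carry the whole
  lattice of an arrangement with only double and triple points, and they are easy to move along a
  relabelling.\<close>

definition concurrent_triples :: "(nat \<times> nat \<Rightarrow> cvec) \<Rightarrow> (nat \<times> nat) set set" where
  "concurrent_triples L = {S. S \<subseteq> idx \<and> card S = 3 \<and> concurrent L S}"

definition inner_triples :: "(nat \<times> nat \<Rightarrow> cvec) \<Rightarrow> (nat \<times> nat) set set" where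
  "inner_triples L = {class_minus j e | j e. j < 3 \<and> e < 4 \<and> concurrent L (class_minus j e)}"

definition mixed_triples :: "(nat \<times> nat \<Rightarrow> cvec) \<Rightarrow> (nat \<times> nat) set set" where
  "mixed_triples L = {transversal a b c | a b c. a < 4 \<and> b < 4 \<and> c < 4 \<and> concurrent L (transversal a b c)}"

lemma finite_concurrent_triples [simp]: "finite (concurrent_triples L)"
  by (rule finite_subset[of _ "Pow idx"]) (auto simp: concurrent_triples_def)

lemma concurrent_iff_dot: "concurrent L S \<longleftrightarrow> (\<exists>p. nonzero p \<and> (\<forall>i\<in>S. dot (L i) p = 0))"
  by (simp add: concurrent_def incident_iff_dot)

lemma in_lines_through: "i \<in> lines_through L p \<longleftrightarrow> i \<in> idx \<and> dot (L i) p = 0"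
  by (simp add: lines_through_def incident_iff_dot)

lemma finite_lines_through [simp]: "finite (lines_through L p)"
  by (rule finite_subset[OF _ finite_idx]) (auto simp: lines_through_def)

lemma type_i_iff:
  assumes "j < 3"
  shows "type_i L j \<longleftrightarrow> (\<exists>e<4. concurrent L (class_minus j e))"
proof
  assume "type_i L j"
  then obtain k1 k2 k3 p where k: "k1 < 4" "k2 < 4" "k3 < 4" "k1 \<noteq> k2" "k1 \<noteq> k3" "k2 \<noteq> k3"
    and p: "nonzero p" "dot (L (j, k1)) p = 0" "dot (L (j, k2)) p = 0" "dot (L (j, k3)) p = 0"
    by (auto simp: type_i_def incident_iff_dot)
  \<comment> \<open>Since 0 + 1 + 2 + 3 = 6, this is the index missed by the three others.\<close>
  define e where "e = 6 - k1 - k2 - k3"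
  have "k \<in> {0, 1, 2, 3}" if "k < 4" for k :: nat using that by auto
  then have "k1 \<in> {0, 1, 2, 3}" "k2 \<in> {0, 1, 2, 3}" "k3 \<in> {0, 1, 2, 3}" using k by auto
  then have "e < 4" "{..<4} - {e} \<subseteq> {k1, k2, k3}"
    using k(4-6) by (auto simp: e_def numeral_eq_Suc lessThan_Suc)
  then have "concurrent L (class_minus j e)"
    unfolding concurrent_iff_dot class_minus_def using p by blast
  with \<open>e < 4\<close> show "\<exists>e<4. concurrent L (class_minus j e)" by blast
next
  assume "\<exists>e<4. concurrent L (class_minus j e)"
  then obtain e p where e: "e < 4" and p: "nonzero p" "\<And>k. k < 4 \<Longrightarrow> k \<noteq> e \<Longrightarrow> dot (L (j, k)) p = 0"
    by (auto simp: concurrent_iff_dot class_minus_def)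
  have "card ({..<4} - {e}) = 3" using e by simp
  then obtain k1 k2 k3 where "{..<4} - {e} = {k1, k2, k3}" "k1 \<noteq> k2" "k1 \<noteq> k3" "k2 \<noteq> k3"
    by (auto simp: card_3_iff)
  moreover from this have "k1 < 4" "k1 \<noteq> e" "k2 < 4" "k2 \<noteq> e" "k3 < 4" "k3 \<noteq> e" by blast+
  ultimately show "type_i L j"
    unfolding type_i_def incident_iff_dot using p by blast
qed

section \<open>Counting the triple points of a net\<close>

locale net34 =
  fixes L :: "nat \<times> nat \<Rightarrow> cvec"
  assumes net: "is_34_net L" and double_triple: "only_double_triple L"
begin

lemma nonzero_meet: "i \<in> idx \<Longrightarrow> i' \<in> idx \<Longrightarrow> i \<noteq> i' \<Longrightarrow> nonzero (cross (L i) (L i'))"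
  by (rule nonzero_cross) (use net in \<open>simp_all add: is_34_net_def\<close>)

lemma concurrent3_iff:
  "i \<in> idx \<Longrightarrow> i' \<in> idx \<Longrightarrow> i \<noteq> i' \<Longrightarrow>
    concurrent L {i, i', i''} \<longleftrightarrow> det3 (L i) (L i') (L i'') = 0"
  unfolding concurrent_iff_det3[OF nonzero_meet, symmetric] concurrent_iff_dot by simp

lemma card_lines_through_le: "nonzero p \<Longrightarrow> card (lines_through L p) \<le> 3"
  using double_triple[unfolded only_double_triple_def, rule_format, of p] by linarith

lemma unique_in_class:
  assumes "nonzero p" "i \<in> idx" "i' \<in> idx" "fst i \<noteq> fst i'" "dot (L i) p = 0" "dot (L i') p = 0"
    and "m < 3"
  shows "\<exists>!k. k < 4 \<and> dot (L (m, k)) p = 0"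
proof -
  obtain j k j' k' where "i = (j, k)" "i' = (j', k')" by (cases i; cases i')
  then show ?thesis
    using assms
      net[unfolded is_34_net_def incident_iff_dot, THEN conjunct2, THEN conjunct2,
        rule_format, of p j k j' k' m]
    by simp
qed

lemma same_class_not_mixed:
  assumes "nonzero p" "dot (L (j, k)) p = 0" "dot (L (j, k')) p = 0" "k \<noteq> k'"
    and "j < 3" "k < 4" "k' < 4" "m < 3" "l < 4" "m \<noteq> j"
  shows "dot (L (m, l)) p \<noteq> 0"
proof
  assume "dot (L (m, l)) p = 0"
  then have "\<exists>!k. k < 4 \<and> dot (L (j, k)) p = 0"
    using assms by (intro unique_in_class[of p "(j, k)" "(m, l)" j]) simp_all
  then show False using assms by blast
qed

lemma same_point:
  assumes "nonzero p" "nonzero q" "i \<noteq> i'"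
    and "i \<in> lines_through L p" "i' \<in> lines_through L p"
    and "i \<in> lines_through L q" "i' \<in> lines_through L q"
  shows "proportional p q"
proof -
  have n: "nonzero (cross (L i) (L i'))"
    using assms nonzero_meet by (simp add: in_lines_through)
  show ?thesis
    using assms proportional_trans[OF proportional_sym[OF proportional_cross[OF n]] proportional_cross[OF n]]
    by (simp add: in_lines_through)
qed

lemma lines_through_proportional: "proportional p q \<Longrightarrow> lines_through L p = lines_through L q"
  using proportional_dot unfolding lines_through_def incident_iff_dot by blast

lemma lines_through_eq:
  assumes "S \<in> concurrent_triples L" "nonzero p" "\<forall>i\<in>S. dot (L i) p = 0"
  shows "lines_through L p = S"
proof -
  have "S \<subseteq> lines_through L p"
    using assms by (auto simp: concurrent_triples_def in_lines_through)
  then show ?thesis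
    using card_seteq[OF finite_lines_through, of S L p] card_lines_through_le[OF assms(2)] assms(1)
    by (simp add: concurrent_triples_def)
qed

text \<open>Up to scaling of points, taking the centre of a concurrent triple is inverse to
  \<open>lines_through\<close>, because no fourth line passes through the centre.\<close>

lemma num_triple_points_eq: "num_triple_points L = card (concurrent_triples L)"
proof -
  define centre where "centre S = (SOME p. nonzero p \<and> (\<forall>i\<in>S. dot (L i) p = 0))" for S
  have centre: "nonzero (centre S)" "lines_through L (centre S) = S" if "S \<in> concurrent_triples L" for S
  proof -
    have "\<exists>p. nonzero p \<and> (\<forall>i\<in>S. dot (L i) p = 0)"
      using that by (simp add: concurrent_triples_def concurrent_iff_dot)
    then have *: "nonzero (centre S) \<and> (\<forall>i\<in>S. dot (L i) (centre S) = 0)"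
      unfolding centre_def by (rule someI_ex)
    then show "nonzero (centre S)" "lines_through L (centre S) = S"
      using lines_through_eq[OF that] by auto
  qed
  have "bij_betw (\<lambda>S. proj_point (centre S)) (concurrent_triples L) (triple_points L)"
  proof (rule bij_betw_imageI)
    show "inj_on (\<lambda>S. proj_point (centre S)) (concurrent_triples L)"
      by (rule inj_onI) (metis centre(2) proj_point_eq_iff lines_through_proportional)
    show "(\<lambda>S. proj_point (centre S)) ` concurrent_triples L = triple_points L"
    proof
      show "(\<lambda>S. proj_point (centre S)) ` concurrent_triples L \<subseteq> triple_points L"
      proof (intro image_subsetI)
        fix S assume S: "S \<in> concurrent_triples L"
        then have "card (lines_through L (centre S)) = 3"
          using centre(2) by (simp add: concurrent_triples_def)
        with centre(1)[OF S] show "proj_point (centre S) \<in> triple_points L"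
          unfolding triple_points_def by blast
      qed
      show "triple_points L \<subseteq> (\<lambda>S. proj_point (centre S)) ` concurrent_triples L"
      proof
        fix x assume "x \<in> triple_points L"
        then obtain p where x: "x = proj_point p" and p: "nonzero p" "card (lines_through L p) = 3"
          by (auto simp: triple_points_def)
        define S where "S = lines_through L p"
        have S: "S \<in> concurrent_triples L"
          using p by (auto simp: concurrent_triples_def S_def concurrent_iff_dot in_lines_through)
        obtain i i' where "i \<in> S" "i' \<in> S" "i \<noteq> i'"
          using p unfolding S_def[symmetric] by (auto simp: card_3_iff)
        then have "proportional p (centre S)"
          using same_point[of p "centre S" i i'] p centre[OF S] S_def by auto
        then show "x \<in> (\<lambda>S. proj_point (centre S)) ` concurrent_triples L"
          using S x proj_point_eq_iff by blast
      qed
    qed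
  qed
  then show ?thesis
    by (simp add: num_triple_points_def bij_betw_same_card)
qed

text \<open>Two lines of the projective plane always meet, and no four lines of the arrangement are
  concurrent. Only the sets of size 3 carry information.\<close>

lemma concurrent_iff:
  assumes "S \<subseteq> idx"
  shows "concurrent L S \<longleftrightarrow> card S \<le> 2 \<or> S \<in> concurrent_triples L"
proof
  assume c: "concurrent L S"
  then obtain p where p: "nonzero p" "\<forall>i\<in>S. dot (L i) p = 0" by (auto simp: concurrent_iff_dot)
  then have "S \<subseteq> lines_through L p" using assms by (auto simp: in_lines_through)
  then have "card S \<le> 3"
    using card_mono[OF finite_lines_through] card_lines_through_le p by (meson le_trans)
  with c assms show "card S \<le> 2 \<or> S \<in> concurrent_triples L"
    by (auto simp: concurrent_triples_def)
next
  assume "card S \<le> 2 \<or> S \<in> concurrent_triples L"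
  then show "concurrent L S"
  proof
    assume "card S \<le> 2"
    \<comment> \<open>Smaller sets are padded to two distinct lines, so that the cross product gives
      a common point in every case.\<close>
    then obtain i i' where i: "S \<subseteq> {i, i'}" "i \<in> idx" "i' \<in> idx" "i \<noteq> i'"
    proof -
      have fin: "finite S" by (rule finite_subset[OF assms finite_idx])
      consider "card S = 0" | "card S = 1" | "card S = 2" using \<open>card S \<le> 2\<close> by linarith
      then show thesis
      proof cases
        case 1
        then show thesis using that[of "(0,0)" "(0,1)"] fin by simp
      next
        case 2
        then obtain i where "S = {i}" by (auto simp: card_1_singleton_iff)
        then show thesis using that[of i "if i = (0,0) then (0,1) else (0,0)"] assms
          by (auto split: if_splits)
      next
        case 3
        then obtain i i' where "S = {i, i'}" "i \<noteq> i'" by (auto simp: card_2_iff)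
        then show thesis using that[of i i'] assms by simp
      qed
    qed
    then have "nonzero (cross (L i) (L i'))" using nonzero_meet by blast
    moreover have "\<forall>k\<in>S. dot (L k) (cross (L i) (L i')) = 0" using i by auto
    ultimately show "concurrent L S" unfolding concurrent_iff_dot by blast
  qed (simp add: concurrent_triples_def)
qed

text \<open>Two such triples share two lines, hence their centre, and the lines through that centre
  determine the triple.\<close>

lemma unique_class_minus:
  assumes "concurrent L (class_minus j e)" "concurrent L (class_minus j e')" "j < 3" "e < 4" "e' < 4"
  shows "e = e'"
proof (rule ccontr)
  assume ne: "e \<noteq> e'"
  have S: "class_minus j e \<in> concurrent_triples L" "class_minus j e' \<in> concurrent_triples L"
    using assms class_minus_subset card_class_minus by (auto simp: concurrent_triples_def)
  obtain p where p: "nonzero p" "\<forall>i\<in>class_minus j e. dot (L i) p = 0"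
    using assms by (auto simp: concurrent_iff_dot)
  obtain q where q: "nonzero q" "\<forall>i\<in>class_minus j e'. dot (L i) q = 0"
    using assms by (auto simp: concurrent_iff_dot)
  have lp: "lines_through L p = class_minus j e" "lines_through L q = class_minus j e'"
    using lines_through_eq S p q by auto
  have "card ({..<4} - {e, e'}) = 2" using assms ne by (simp add: card_Diff_subset)
  then obtain k k' where "{..<4} - {e, e'} = {k, k'}" "k \<noteq> k'" by (auto simp: card_2_iff)
  then have "(j, k) \<in> class_minus j e" "(j, k') \<in> class_minus j e"
    "(j, k) \<in> class_minus j e'" "(j, k') \<in> class_minus j e'"
    by (auto simp: class_minus_def)
  then have "proportional p q"
    using same_point[of p q "(j, k)" "(j, k')"] p q lp \<open>k \<noteq> k'\<close> by auto
  then have "class_minus j e = class_minus j e'"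
    using lines_through_proportional lp by simp
  then show False using class_minus_inject ne assms by simp
qed

lemma card_inner_triples: "card (inner_triples L) = num_type_i L"
proof -
  define e where "e j = (SOME e. e < 4 \<and> concurrent L (class_minus j e))" for j
  have e: "e j < 4 \<and> concurrent L (class_minus j (e j))" if "j < 3" "type_i L j" for j
    using that type_i_iff[of j L] unfolding e_def by (metis (mono_tags, lifting) someI_ex)
  have "bij_betw (\<lambda>j. class_minus j (e j)) {j. j < 3 \<and> type_i L j} (inner_triples L)"
  proof (rule bij_betw_imageI)
    show "inj_on (\<lambda>j. class_minus j (e j)) {j. j < 3 \<and> type_i L j}"
      using e by (auto intro!: inj_onI simp: class_minus_inject)
    show "(\<lambda>j. class_minus j (e j)) ` {j. j < 3 \<and> type_i L j} = inner_triples L"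
    proof
      show "(\<lambda>j. class_minus j (e j)) ` {j. j < 3 \<and> type_i L j} \<subseteq> inner_triples L"
        using e by (auto simp: inner_triples_def)
      show "inner_triples L \<subseteq> (\<lambda>j. class_minus j (e j)) ` {j. j < 3 \<and> type_i L j}"
      proof
        fix S assume "S \<in> inner_triples L"
        then obtain j e' where S: "S = class_minus j e'" "j < 3" "e' < 4" "concurrent L (class_minus j e')"
          by (auto simp: inner_triples_def)
        then have "type_i L j" using type_i_iff by blast
        moreover have "e' = e j" using unique_class_minus e S \<open>type_i L j\<close> by blast
        ultimately show "S \<in> (\<lambda>j. class_minus j (e j)) ` {j. j < 3 \<and> type_i L j}"
          using S by blast
      qed
    qed
  qed
  then show ?thesis by (simp add: num_type_i_def bij_betw_same_card)
qed

lemma ex1_third_line: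
  assumes "a < 4" "b < 4"
  shows "\<exists>!c. c < 4 \<and> concurrent L (transversal a b c)"
proof -
  let ?p = "cross (L (0, a)) (L (1, b))"
  have p: "nonzero ?p" using nonzero_meet assms by simp
  have "concurrent L (transversal a b c) \<longleftrightarrow> dot (L (2, c)) ?p = 0" for c
    using concurrent3_iff[of "(0, a)" "(1, b)"] assms by (simp add: transversal_def det3_def)
  then show ?thesis
    using unique_in_class[OF p, of "(0, a)" "(1, b)" 2] assms by simp
qed

lemma card_mixed_triples: "card (mixed_triples L) = 16"
proof -
  define c where "c a b = (THE c. c < 4 \<and> concurrent L (transversal a b c))" for a b
  have c: "c a b < 4 \<and> concurrent L (transversal a b (c a b))" if "a < 4" "b < 4" for a b
    unfolding c_def by (rule theI'[OF ex1_third_line[OF that]])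
  have "bij_betw (\<lambda>(a, b). transversal a b (c a b)) ({..<4} \<times> {..<4}) (mixed_triples L)"
  proof (rule bij_betw_imageI)
    show "inj_on (\<lambda>(a, b). transversal a b (c a b)) ({..<4} \<times> {..<4})"
      by (auto intro!: inj_onI simp: transversal_inject)
    show "(\<lambda>(a, b). transversal a b (c a b)) ` ({..<4} \<times> {..<4}) = mixed_triples L"
    proof
      show "(\<lambda>(a, b). transversal a b (c a b)) ` ({..<4} \<times> {..<4}) \<subseteq> mixed_triples L"
        unfolding mixed_triples_def using c by (clarsimp, blast)
      show "mixed_triples L \<subseteq> (\<lambda>(a, b). transversal a b (c a b)) ` ({..<4} \<times> {..<4})"
      proof
        fix S assume "S \<in> mixed_triples L"
        then obtain x y z where S: "S = transversal x y z" "x < 4" "y < 4" "z < 4"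
          "concurrent L (transversal x y z)"
          by (auto simp: mixed_triples_def)
        then have "z = c x y" using ex1_third_line[of x y] c by blast
        with S show "S \<in> (\<lambda>(a, b). transversal a b (c a b)) ` ({..<4} \<times> {..<4})" by auto
      qed
    qed
  qed
  from bij_betw_same_card[OF this] show ?thesis by simp
qed

text \<open>By the net property, a point on lines of two classes has a line of every class through
  it. A concurrent triple is therefore either a transversal or contained in one class.\<close>

lemma concurrent_triples_eq: "concurrent_triples L = mixed_triples L \<union> inner_triples L"
proof
  show "mixed_triples L \<union> inner_triples L \<subseteq> concurrent_triples L"
    unfolding mixed_triples_def inner_triples_def concurrent_triples_def
    using transversal_subset card_transversal class_minus_subset card_class_minus by blast
  show "concurrent_triples L \<subseteq> mixed_triples L \<union> inner_triples L"
  proof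
    fix S assume S: "S \<in> concurrent_triples L"
    then have "S \<subseteq> idx" "card S = 3" and conc: "concurrent L S"
      by (auto simp: concurrent_triples_def)
    then obtain p where p: "nonzero p" "\<forall>i\<in>S. dot (L i) p = 0" by (auto simp: concurrent_iff_dot)
    have lt: "lines_through L p = S" using lines_through_eq S p by blast
    show "S \<in> mixed_triples L \<union> inner_triples L"
    proof (cases "\<exists>i\<in>S. \<exists>i'\<in>S. fst i \<noteq> fst i'")
      case True
      then obtain i i' where i: "i \<in> S" "i' \<in> S" "fst i \<noteq> fst i'" by blast
      have "\<exists>k<4. (m, k) \<in> S" if "m < 3" for m
        using unique_in_class[OF p(1) _ _ i(3) _ _ that] i p \<open>S \<subseteq> idx\<close> that
        unfolding lt[symmetric] in_lines_through in_idx by blast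
      then obtain a b c where abc: "a < 4" "(0, a) \<in> S" "b < 4" "(1, b) \<in> S" "c < 4" "(2, c) \<in> S"
        by (metis zero_less_numeral one_less_numeral_iff semiring_norm(77) lessI numeral_3_eq_3 numeral_2_eq_2)
      then have "transversal a b c \<subseteq> S" by (simp add: transversal_def)
      then have "S = transversal a b c"
        using card_subset_eq[of S] \<open>S \<subseteq> idx\<close> \<open>card S = 3\<close> card_transversal finite_subset[OF _ finite_idx]
        by metis
      then show ?thesis using abc conc by (auto simp: mixed_triples_def)
    next
      case False
      obtain i where "i \<in> S" using \<open>card S = 3\<close> by (auto simp: card_3_iff)
      define j where "j = fst i"
      have j: "j < 3" using \<open>i \<in> S\<close> \<open>S \<subseteq> idx\<close> by (cases i) (auto simp: j_def)
      have sub: "S \<subseteq> {j} \<times> {..<4}"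
      proof
        fix x assume x: "x \<in> S"
        with False \<open>i \<in> S\<close> have "fst x = j" unfolding j_def by blast
        then show "x \<in> {j} \<times> {..<4}" using x \<open>S \<subseteq> idx\<close> by (cases x) auto
      qed
      then have "card ({j} \<times> {..<4::nat} - S) = 1"
        using \<open>card S = 3\<close> finite_subset[OF sub] by (simp add: card_Diff_subset)
      then obtain y where y: "{j} \<times> {..<4} - S = {y}" by (auto simp: card_1_singleton_iff)
      then obtain e where e: "y = (j, e)" "e < 4" by (cases y) blast
      have "S = {j} \<times> {..<4} - {y}" using y sub by blast
      then have "S = class_minus j e" using e by (auto simp: class_minus_def)
      then show ?thesis using e j conc by (auto simp: inner_triples_def)
    qed
  qed
qed

lemma card_concurrent_triples: "card (concurrent_triples L) = 16 + num_type_i L"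
proof -
  have "mixed_triples L \<inter> inner_triples L = {}"
    unfolding mixed_triples_def inner_triples_def using transversal_neq_class_minus by blast
  then show ?thesis
    using finite_concurrent_triples[of L] unfolding concurrent_triples_eq
    by (simp add: card_Un_disjoint card_mixed_triples card_inner_triples)
qed

lemma latin_entry_eq:
  assumes "a < 4" "b < 4" "c < 4"
  shows "concurrent L (transversal a b c) \<longleftrightarrow> (a, b, c) \<in> square_triples (latin_entry L)"
proof -
  have *: "latin_entry L a b = (THE c. c < 4 \<and> concurrent L (transversal a b c))"
    by (simp add: latin_entry_def concurrent_def transversal_def)
  show ?thesis
    using theI'[OF ex1_third_line[OF assms(1,2)]] ex1_third_line[OF assms(1,2)] assms
    unfolding *[symmetric] by (auto simp: square_triples_def)
qed

end

lemma lattice_isomorphicI: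
  assumes "net34 L" "net34 L'" "bij_betw \<sigma> idx idx"
    and "\<And>S. S \<subseteq> idx \<Longrightarrow> S \<in> concurrent_triples L \<longleftrightarrow> \<sigma> ` S \<in> concurrent_triples L'"
  shows "lattice_isomorphic L L'"
  unfolding lattice_isomorphic_def
proof (intro exI conjI allI impI)
  fix S assume S: "S \<subseteq> idx"
  have "card (\<sigma> ` S) = card S"
    by (rule card_image[OF inj_on_subset[OF bij_betw_imp_inj_on[OF assms(3)] S]])
  moreover have img: "\<sigma> ` S \<subseteq> idx" using S assms(3) by (auto simp: bij_betw_def)
  ultimately show "concurrent L S \<longleftrightarrow> concurrent L' (\<sigma> ` S)"
    by (simp add: net34.concurrent_iff[OF assms(1) S] net34.concurrent_iff[OF assms(2) img] assms(4)[OF S])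
qed fact

section \<open>Relabelling\<close>

text \<open>A renaming that carries classes to classes, so that \<open>L \<circ> \<sigma>\<close> is
  the same net under other names.\<close>

definition reindexing :: "(nat \<times> nat \<Rightarrow> nat \<times> nat) \<Rightarrow> bool" where
  "reindexing \<sigma> \<longleftrightarrow> bij_betw \<sigma> idx idx \<and>
     (\<forall>i\<in>idx. \<forall>i'\<in>idx. fst (\<sigma> i) = fst (\<sigma> i') \<longleftrightarrow> fst i = fst i')"

lemma reindexing_bij: "reindexing \<sigma> \<Longrightarrow> bij_betw \<sigma> idx idx"
  by (simp add: reindexing_def)

lemma reindexing_inj: "reindexing \<sigma> \<Longrightarrow> inj_on \<sigma> idx"
  by (simp add: reindexing_def bij_betw_def)

lemma reindexing_in_idx: "reindexing \<sigma> \<Longrightarrow> i \<in> idx \<Longrightarrow> \<sigma> i \<in> idx"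
  using bij_betwE[OF reindexing_bij] by blast

lemma reindexing_class:
  "reindexing \<sigma> \<Longrightarrow> i \<in> idx \<Longrightarrow> i' \<in> idx \<Longrightarrow> fst (\<sigma> i) = fst (\<sigma> i') \<longleftrightarrow> fst i = fst i'"
  by (simp add: reindexing_def)

lemma reindexing_comp:
  assumes "reindexing \<sigma>" "reindexing \<rho>"
  shows "reindexing (\<sigma> \<circ> \<rho>)"
  unfolding reindexing_def
proof (intro conjI ballI)
  show "bij_betw (\<sigma> \<circ> \<rho>) idx idx"
    using bij_betw_trans reindexing_bij assms by blast
qed (simp add: reindexing_class assms reindexing_in_idx)

lemma reindexing_class_minus:
  assumes \<sigma>: "reindexing \<sigma>" and m: "m < 3" "e < 4" and eq: "\<sigma> (m, e) = (m', e')"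
  shows "\<sigma> ` class_minus m e = class_minus m' e'"
proof (rule card_subset_eq)
  have "(m', e') \<in> idx" using reindexing_in_idx[OF \<sigma>, of "(m, e)"] m eq by simp
  then have "e' < 4" by simp
  have inj: "inj_on \<sigma> (class_minus m e)"
    using inj_on_subset[OF reindexing_inj[OF \<sigma>]] class_minus_subset m by blast
  show "card (\<sigma> ` class_minus m e) = card (class_minus m' e')"
    by (simp add: card_image[OF inj] card_class_minus m \<open>e' < 4\<close>)
  show "finite (class_minus m' e')" by (simp add: class_minus_def)
  show "\<sigma> ` class_minus m e \<subseteq> class_minus m' e'"
  proof (rule image_subsetI)
    fix i assume "i \<in> class_minus m e"
    then obtain k where i: "i = (m, k)" "k < 4" "k \<noteq> e" by (auto simp: class_minus_def)
    obtain n l where s: "\<sigma> i = (n, l)" by (cases "\<sigma> i")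
    have "(n, l) \<in> idx" using reindexing_in_idx[OF \<sigma>, of i] i m s by simp
    moreover have "n = m'"
      using reindexing_class[OF \<sigma>, of i "(m, e)"] i m s eq by simp
    moreover have "(n, l) \<noteq> (m', e')"
      using inj_onD[OF reindexing_inj[OF \<sigma>], of i "(m, e)"] i m s eq by auto
    ultimately show "\<sigma> i \<in> class_minus m' e'" by (simp add: s class_minus_def)
  qed
qed

lemma concurrent_comp: "concurrent (L \<circ> \<sigma>) S \<longleftrightarrow> concurrent L (\<sigma> ` S)"
  by (simp add: concurrent_def)

lemma concurrent_triples_comp:
  assumes "bij_betw \<sigma> idx idx" "S \<subseteq> idx"
  shows "S \<in> concurrent_triples (L \<circ> \<sigma>) \<longleftrightarrow> \<sigma> ` S \<in> concurrent_triples L"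
proof -
  have "card (\<sigma> ` S) = card S"
    by (rule card_image[OF inj_on_subset[OF bij_betw_imp_inj_on[OF assms(1)] assms(2)]])
  moreover have "\<sigma> ` S \<subseteq> idx" using assms by (auto simp: bij_betw_def)
  ultimately show ?thesis using assms(2) by (simp add: concurrent_triples_def concurrent_comp)
qed

lemma net34_comp:
  assumes "net34 L" and \<sigma>: "reindexing \<sigma>"
  shows "net34 (L \<circ> \<sigma>)"
proof
  interpret net34 L by fact
  show "is_34_net (L \<circ> \<sigma>)"
    unfolding is_34_net_def incident_iff_dot
  proof (intro conjI ballI impI allI)
    fix i assume "i \<in> idx"
    then show "nonzero ((L \<circ> \<sigma>) i)"
      using net reindexing_in_idx[OF \<sigma>] by (simp add: is_34_net_def)
  next
    fix i i' assume i: "i \<in> idx" "i' \<in> idx" "i \<noteq> i'"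
    then have "\<sigma> i \<noteq> \<sigma> i'" using inj_onD[OF reindexing_inj[OF \<sigma>]] by blast
    with i show "\<not> proportional ((L \<circ> \<sigma>) i) ((L \<circ> \<sigma>) i')"
      using net reindexing_in_idx[OF \<sigma>] by (simp add: is_34_net_def)
  next
    fix p j k j' k' and m :: nat
    assume p: "nonzero p" and m: "m < 3"
    assume h: "(j, k) \<in> idx \<and> (j', k') \<in> idx \<and> j \<noteq> j' \<and>
      dot ((L \<circ> \<sigma>) (j, k)) p = 0 \<and> dot ((L \<circ> \<sigma>) (j', k')) p = 0"
    \<comment> \<open>The class onto which class \<open>m\<close> is carried; index 0 is an
      arbitrary representative.\<close>
    define m' where "m' = fst (\<sigma> (m, 0))"
    have m'3: "m' < 3"
      using reindexing_in_idx[OF \<sigma>, of "(m, 0)"] m by (cases "\<sigma> (m, 0)") (simp add: m'_def)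
    have "\<exists>!c. c < 4 \<and> dot (L (m', c)) p = 0"
      using h reindexing_in_idx[OF \<sigma>] reindexing_class[OF \<sigma>, of "(j, k)" "(j', k')"]
      by (intro unique_in_class[OF p, of "\<sigma> (j, k)" "\<sigma> (j', k')"] m'3) auto
    then obtain c where c: "c < 4" "dot (L (m', c)) p = 0"
      and uniq: "\<And>c'. c' < 4 \<Longrightarrow> dot (L (m', c')) p = 0 \<Longrightarrow> c' = c" by blast
    have "(m', c) \<in> \<sigma> ` idx"
      using bij_betw_imp_surj_on[OF reindexing_bij[OF \<sigma>]] c m'3 by simp
    then obtain m2 k2 where k2: "(m2, k2) \<in> idx" "\<sigma> (m2, k2) = (m', c)"
      by (metis imageE surj_pair)
    have "m2 = m"
      using reindexing_class[OF \<sigma>, of "(m2, k2)" "(m, 0)"] k2 m by (simp add: m'_def)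
    show "\<exists>!k. k < 4 \<and> dot ((L \<circ> \<sigma>) (m, k)) p = 0"
    proof (rule ex1I)
      show "k2 < 4 \<and> dot ((L \<circ> \<sigma>) (m, k2)) p = 0" using k2 c \<open>m2 = m\<close> by simp
      fix l assume l: "l < 4 \<and> dot ((L \<circ> \<sigma>) (m, l)) p = 0"
      obtain n d where nd: "\<sigma> (m, l) = (n, d)" by (cases "\<sigma> (m, l)")
      have "n = m'" using reindexing_class[OF \<sigma>, of "(m, l)" "(m, 0)"] l m nd by (simp add: m'_def)
      moreover have "d < 4" using reindexing_in_idx[OF \<sigma>, of "(m, l)"] l m nd by simp
      ultimately have "\<sigma> (m, l) = \<sigma> (m, k2)" using uniq[of d] l nd k2 \<open>m2 = m\<close> by simp
      then show "l = k2"
        using inj_onD[OF reindexing_inj[OF \<sigma>], of "(m, l)" "(m, k2)"] l k2 \<open>m2 = m\<close> by simp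
    qed
  qed
  have "card (lines_through (L \<circ> \<sigma>) p) = card (lines_through L p)" for p
  proof -
    have "\<sigma> ` lines_through (L \<circ> \<sigma>) p = lines_through L p"
    proof
      show "\<sigma> ` lines_through (L \<circ> \<sigma>) p \<subseteq> lines_through L p"
        using reindexing_in_idx[OF \<sigma>] by (intro image_subsetI) (simp add: lines_through_def)
      show "lines_through L p \<subseteq> \<sigma> ` lines_through (L \<circ> \<sigma>) p"
      proof
        fix i assume i: "i \<in> lines_through L p"
        then have "i \<in> \<sigma> ` idx"
          using bij_betw_imp_surj_on[OF reindexing_bij[OF \<sigma>]] by (simp add: in_lines_through)
        then obtain i' where "i' \<in> idx" "i = \<sigma> i'" by blast
        with i show "i \<in> \<sigma> ` lines_through (L \<circ> \<sigma>) p"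
          by (intro image_eqI[of _ _ i']) (simp_all add: in_lines_through)
      qed
    qed
    moreover have "inj_on \<sigma> (lines_through (L \<circ> \<sigma>) p)"
      by (rule inj_on_subset[OF reindexing_inj[OF \<sigma>]]) (auto simp: lines_through_def)
    ultimately show ?thesis by (metis card_image)
  qed
  then show "only_double_triple (L \<circ> \<sigma>)"
    using double_triple by (simp add: only_double_triple_def)
qed

text \<open>The count of all concurrent triples is visibly invariant and exceeds the number of type
  (i) classes by 16 on both sides, so no class has to be followed individually.\<close>

lemma num_type_i_comp:
  assumes "net34 L" "reindexing \<sigma>"
  shows "num_type_i (L \<circ> \<sigma>) = num_type_i L"
proof -
  have "(`) \<sigma> ` concurrent_triples (L \<circ> \<sigma>) = concurrent_triples L"
  proof
    show "(`) \<sigma> ` concurrent_triples (L \<circ> \<sigma>) \<subseteq> concurrent_triples L"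
      using concurrent_triples_comp[OF reindexing_bij[OF assms(2)]]
      by (auto simp: concurrent_triples_def)
    show "concurrent_triples L \<subseteq> (`) \<sigma> ` concurrent_triples (L \<circ> \<sigma>)"
    proof
      fix T assume T: "T \<in> concurrent_triples L"
      then have "T \<subseteq> \<sigma> ` idx"
        using bij_betw_imp_surj_on[OF reindexing_bij[OF assms(2)]] by (auto simp: concurrent_triples_def)
      then obtain S where "S \<subseteq> idx" "T = \<sigma> ` S" by (auto simp: subset_image_iff)
      then show "T \<in> (`) \<sigma> ` concurrent_triples (L \<circ> \<sigma>)"
        using T concurrent_triples_comp[OF reindexing_bij[OF assms(2)], of S L] by blast
    qed
  qed
  moreover have "inj_on ((`) \<sigma>) (concurrent_triples (L \<circ> \<sigma>))"
    by (rule inj_on_subset[OF inj_on_image_Pow[OF reindexing_inj[OF assms(2)]]])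
      (auto simp: concurrent_triples_def)
  ultimately have "card (concurrent_triples (L \<circ> \<sigma>)) = card (concurrent_triples L)"
    by (metis card_image)
  then show ?thesis
    using net34.card_concurrent_triples net34_comp assms by fastforce
qed

definition relabel :: "(nat \<Rightarrow> nat) \<Rightarrow> (nat \<Rightarrow> nat \<Rightarrow> nat) \<Rightarrow> nat \<times> nat \<Rightarrow> nat \<times> nat" where
  "relabel \<pi> F = (\<lambda>(j, k). (\<pi> j, F j k))"

lemma reindexing_relabel:
  assumes p: "bij_betw \<pi> {..<3} {..<3}" and F: "\<And>j. j < 3 \<Longrightarrow> bij_betw (F j) {..<4} {..<4}"
  shows "reindexing (relabel \<pi> F)"
proof -
  have inj\<pi>: "j = j'" if "\<pi> j = \<pi> j'" "j < 3" "j' < 3" for j j'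
    using inj_onD[OF bij_betw_imp_inj_on[OF p]] that by simp
  have injF: "k = k'" if "F j k = F j k'" "j < 3" "k < 4" "k' < 4" for j k k'
    using inj_onD[OF bij_betw_imp_inj_on[OF F[of j]]] that by simp
  have into: "\<pi> j < 3" "k < 4 \<Longrightarrow> F j k < 4" if "j < 3" for j k
    using bij_betwE[OF p] bij_betwE[OF F[OF that]] that by auto
  have "inj_on (relabel \<pi> F) idx"
  proof (rule inj_onI)
    fix x y assume xy: "x \<in> idx" "y \<in> idx" "relabel \<pi> F x = relabel \<pi> F y"
    obtain j k j' k' where eq: "x = (j, k)" "y = (j', k')" by (cases x; cases y)
    then have "j = j'" using xy inj\<pi>[of j j'] by (simp add: relabel_def)
    then show "x = y" using xy eq injF[of j k k'] by (simp add: relabel_def)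
  qed
  moreover have "relabel \<pi> F ` idx \<subseteq> idx"
    by (auto simp: relabel_def into)
  ultimately have "bij_betw (relabel \<pi> F) idx idx"
    by (simp add: bij_betw_def endo_inj_surj)
  then show ?thesis
    unfolding reindexing_def using inj\<pi> by (auto simp: relabel_def)
qed

text \<open>Since 0 + 1 + 2 = 3, the value \<open>3 - j - j'\<close> is the remaining class.\<close>

definition perm3 :: "nat \<Rightarrow> nat \<Rightarrow> nat \<Rightarrow> nat" where
  "perm3 j j' m = (if m = 0 then j else if m = 1 then j' else 3 - j - j')"

lemma less_3_cases: "(j::nat) < 3 \<Longrightarrow> j = 0 \<or> j = 1 \<or> j = 2"
  by linarith

lemma bij_perm3:
  assumes "j < 3" "j' < 3" "j \<noteq> j'"
  shows "bij_betw (perm3 j j') {..<3} {..<3}"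
proof -
  have "inj_on (perm3 j j') {..<3}"
    using less_3_cases[OF assms(1)] less_3_cases[OF assms(2)] assms(3)
    by (auto intro!: inj_onI simp: perm3_def dest!: less_3_cases split: if_splits)
  moreover have "perm3 j j' ` {..<3} \<subseteq> {..<3}"
    using assms by (auto simp: perm3_def)
  ultimately show ?thesis by (simp add: bij_betw_def endo_inj_surj)
qed

section \<open>Nets over a group of order four\<close>

text \<open>
  \<open>\<nu>\<close> is inversion in the group with table \<open>M\<close>. In the symmetric form \<open>a + b + c = 0\<close> of the
  incidence relation, the three classes play interchangeable roles.
\<close>
locale group4 =
  fixes M :: "nat \<Rightarrow> nat \<Rightarrow> nat" and \<nu> :: "nat \<Rightarrow> nat"
  assumes closed: "a < 4 \<Longrightarrow> b < 4 \<Longrightarrow> M a b < 4"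
    and comm: "a < 4 \<Longrightarrow> b < 4 \<Longrightarrow> M a b = M b a"
    and assoc: "a < 4 \<Longrightarrow> b < 4 \<Longrightarrow> c < 4 \<Longrightarrow> M (M a b) c = M a (M b c)"
    and unit: "a < 4 \<Longrightarrow> M 0 a = a"
    and inv_less: "a < 4 \<Longrightarrow> \<nu> a < 4"
    and inverse: "a < 4 \<Longrightarrow> M (\<nu> a) a = 0"
begin

definition zero_sum :: "(nat \<times> nat \<Rightarrow> cvec) \<Rightarrow> bool" where
  "zero_sum L \<longleftrightarrow> (\<forall>a<4. \<forall>b<4. \<forall>c<4. concurrent L (transversal a b c) \<longleftrightarrow> M (M a b) c = 0)"

lemma cancel: "M a b = M a c \<longleftrightarrow> b = c" if "a < 4" "b < 4" "c < 4"
  by (metis assoc inverse inv_less unit that)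

lemma sum_zero_iff: "M a b = \<nu> c \<longleftrightarrow> M (M a b) c = 0" if "a < 4" "b < 4" "c < 4"
  by (metis cancel closed comm inverse inv_less that)

lemma bij_translate: "e < 4 \<Longrightarrow> bij_betw (M e) {..<4} {..<4}"
proof -
  assume e: "e < 4"
  then have "inj_on (M e) {..<4}" by (intro inj_onI) (simp add: cancel)
  then show ?thesis
    unfolding bij_betw_def using endo_inj_surj[of "{..<4}" "M e"] e by (auto simp: closed image_subset_iff)
qed

lemma bij_inverse: "bij_betw \<nu> {..<4} {..<4}"
proof -
  have "inj_on \<nu> {..<4}"
    by (rule inj_onI) (metis cancel inverse inv_less lessThan_iff)
  then show ?thesis
    unfolding bij_betw_def using endo_inj_surj[of "{..<4}" \<nu>] by (auto simp: inv_less image_subset_iff)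
qed

lemma left_comm: "M a (M b c) = M b (M a c)" if "a < 4" "b < 4" "c < 4"
  by (metis assoc comm that)

lemma zero_sum_any_order:
  assumes "zero_sum L" "j < 3" "j' < 3" "j \<noteq> j'" "a < 4" "b < 4" "c < 4"
  shows "concurrent L {(j, a), (j', b), (3 - j - j', c)} \<longleftrightarrow> M (M a b) c = 0"
proof -
  have *: "concurrent L {(0, a), (Suc 0, b), (2, c)} \<longleftrightarrow> M (M a b) c = 0"
    if "a < 4" "b < 4" "c < 4" for a b c
    using assms(1) that by (simp add: zero_sum_def transversal_def)
  have i: "{x, y, z} = {x, z, y}" "{x, y, z} = {y, x, z}" "{x, y, z} = {y, z, x}"
    "{x, y, z} = {z, x, y}" "{x, y, z} = {z, y, x}" for x y z :: "nat \<times> nat"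
    by auto
  have eqs: "M (M a c) b = M (M a b) c" "M (M b a) c = M (M a b) c" "M (M b c) a = M (M a b) c"
    "M (M c a) b = M (M a b) c" "M (M c b) a = M (M a b) c"
    using assms(5-7) by (simp_all add: assoc closed left_comm comm)
  consider "j = 0" "j' = 1" | "j = 0" "j' = 2" | "j = 1" "j' = 0" | "j = 1" "j' = 2"
    | "j = 2" "j' = 0" | "j = 2" "j' = 1"
    using assms(2-4) by linarith
  then show ?thesis
  proof cases
    case 1 then show ?thesis using *[of a b c] assms(5-7) by simp
  next
    case 2 then show ?thesis
      using *[of a c b] assms(5-7) eqs i(1)[of "(0, a)" "(2, b)" "(Suc 0, c)"] by simp
  next
    case 3 then show ?thesis
      using *[of b a c] assms(5-7) eqs i(2)[of "(Suc 0, a)" "(0, b)" "(2, c)"] by simp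
  next
    case 4 then show ?thesis
      using *[of c a b] assms(5-7) eqs i(4)[of "(Suc 0, a)" "(2, b)" "(0, c)"] by simp
  next
    case 5 then show ?thesis
      using *[of b c a] assms(5-7) eqs i(3)[of "(2, a)" "(0, b)" "(Suc 0, c)"] by simp
  next
    case 6 then show ?thesis
      using *[of c b a] assms(5-7) eqs i(5)[of "(2, a)" "(Suc 0, b)" "(0, c)"] by simp
  qed
qed

text \<open>Translations by e, e' and -(e + e') in the three classes leave a + b + c unchanged. Two
  of them can be chosen freely and the third is then forced, so exactly two left-out lines can be
  put at index 0.\<close>

lemma ex_symmetry:
  assumes L: "zero_sum L" and j: "j < 3" "j' < 3" "j \<noteq> j'" and e: "e < 4" "e' < 4"
  shows "\<exists>\<sigma>. reindexing \<sigma> \<and> zero_sum (L \<circ> \<sigma>) \<and> \<sigma> (0, 0) = (j, e) \<and> \<sigma> (1, 0) = (j', e')"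
proof -
  define f where "f = \<nu> (M e e')"
  have f: "f < 4" by (simp add: f_def e closed inv_less)
  define F where "F m = (if m = 0 then M e else if m = 1 then M e' else M f)" for m :: nat
  define \<sigma> where "\<sigma> = relabel (perm3 j j') F"
  have "reindexing \<sigma>"
    unfolding \<sigma>_def by (rule reindexing_relabel[OF bij_perm3[OF j]]) (simp add: F_def bij_translate e f)
  moreover have "zero_sum (L \<circ> \<sigma>)"
    unfolding zero_sum_def
  proof (intro allI impI)
    fix a b c :: nat assume abc: "a < 4" "b < 4" "c < 4"
    have "\<sigma> ` transversal a b c = {(j, M e a), (j', M e' b), (3 - j - j', M f c)}"
      by (simp add: \<sigma>_def relabel_def perm3_def F_def transversal_def)
    moreover have "M (M (M e a) (M e' b)) (M f c) = M (M a b) c"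
    proof -
      have "M (M (M e a) (M e' b)) (M f c) = M (M f (M e e')) (M (M a b) c)"
        using abc e f by (simp add: assoc closed left_comm comm)
      then show ?thesis using abc e by (simp add: f_def inverse closed unit)
    qed
    ultimately show "concurrent (L \<circ> \<sigma>) (transversal a b c) \<longleftrightarrow> M (M a b) c = 0"
      using zero_sum_any_order[OF L j] abc e f by (simp add: concurrent_comp closed)
  qed
  moreover have "M e 0 = e" "M e' 0 = e'" using comm[of _ 0] unit e by simp_all
  then have "\<sigma> (0, 0) = (j, e)" "\<sigma> (1, 0) = (j', e')"
    by (simp_all add: \<sigma>_def relabel_def perm3_def F_def)
  ultimately show ?thesis by blast
qed

text \<open>The conjugation is undone by permuting the classes, the three bijections are absorbed
  into the relabelling, and inverting the symbols turns c = a + b into a + b + c = 0.\<close>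

lemma ex_zero_sum_form:
  assumes L: "net34 L" and main: "same_main_class M (latin_entry L)"
  shows "\<exists>\<sigma>. reindexing \<sigma> \<and> zero_sum (L \<circ> \<sigma>)"
proof -
  interpret net34 L by fact
  obtain f g h \<tau> where fgh: "bij_betw f {..<4} {..<4}" "bij_betw g {..<4} {..<4}"
      "bij_betw h {..<4} {..<4}" and \<tau>: "\<tau> \<in> conjugations"
    and eq: "square_triples (latin_entry L) = (\<lambda>(a, b, c). (f a, g b, h c)) ` (\<tau> ` square_triples M)"
    using main unfolding same_main_class_def atLeast0LessThan by blast
  have inj: "f x = f y \<longleftrightarrow> x = y" "g x = g y \<longleftrightarrow> x = y" "h x = h y \<longleftrightarrow> x = y"
    if "x < 4" "y < 4" for x y
    using inj_on_eq_iff[OF bij_betw_imp_inj_on[OF fgh(1)]] inj_on_eq_iff[OF bij_betw_imp_inj_on[OF fgh(2)]]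
      inj_on_eq_iff[OF bij_betw_imp_inj_on[OF fgh(3)]] that by auto
  have into: "f x < 4" "g x < 4" "h x < 4" if "x < 4" for x
    using bij_betwE[OF fgh(1)] bij_betwE[OF fgh(2)] bij_betwE[OF fgh(3)] that by auto
  have sq: "(a, b, c) \<in> square_triples M \<longleftrightarrow> a < 4 \<and> b < 4 \<and> c = M a b" for a b c
    by (auto simp: square_triples_def)
  have conc: "concurrent L {(0, f x), (1, g y), (2, h z)} \<longleftrightarrow> (x, y, z) \<in> \<tau> ` square_triples M"
    if "x < 4" "y < 4" "z < 4" for x y z
  proof -
    have range: "x' < 4 \<and> y' < 4 \<and> z' < 4" if "(x', y', z') \<in> \<tau> ` square_triples M" for x' y' z'
      using \<tau> that by (auto simp: conjugations_def sq closed)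
    have "concurrent L {(0, f x), (1, g y), (2, h z)} \<longleftrightarrow>
        (f x, g y, h z) \<in> (\<lambda>(a, b, c). (f a, g b, h c)) ` (\<tau> ` square_triples M)"
      using latin_entry_eq[of "f x" "g y" "h z"] that into by (simp add: eq transversal_def)
    also have "\<dots> \<longleftrightarrow> (\<exists>x' y' z'. (x', y', z') \<in> \<tau> ` square_triples M \<and> f x = f x' \<and> g y = g y' \<and> h z = h z')"
      by (auto simp: image_iff Bex_def split_paired_Ex)
    also have "\<dots> \<longleftrightarrow> (x, y, z) \<in> \<tau> ` square_triples M"
    proof
      assume "\<exists>x' y' z'. (x', y', z') \<in> \<tau> ` square_triples M \<and> f x = f x' \<and> g y = g y' \<and> h z = h z'"
      then obtain x' y' z' where *: "(x', y', z') \<in> \<tau> ` square_triples M"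
        "f x = f x'" "g y = g y'" "h z = h z'" by blast
      then have "x = x'" "y = y'" "z = z'" using range[OF *(1)] that inj by simp_all
      with * show "(x, y, z) \<in> \<tau> ` square_triples M" by simp
    qed blast
    finally show ?thesis .
  qed
  have bij_comp: "bij_betw (\<lambda>x. u (\<nu> x)) {..<4} {..<4}" if "bij_betw u {..<4} {..<4}" for u
    using bij_betw_trans[OF bij_inverse that] by (simp add: comp_def)
  \<comment> \<open>\<open>j\<close>, \<open>j'\<close> and \<open>3 - j - j'\<close> are the
    classes that play the rows, columns and symbols of \<open>M\<close>. The six conjugations differ
    only in this choice.\<close>
  have main_case: "\<exists>\<sigma>. reindexing \<sigma> \<and> zero_sum (L \<circ> \<sigma>)"
    if "j < 3" "j' < 3" "j \<noteq> j'" "bij_betw u {..<4} {..<4}" "bij_betw v {..<4} {..<4}"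
      "bij_betw w {..<4} {..<4}"
      and c: "\<And>a b c. a < 4 \<Longrightarrow> b < 4 \<Longrightarrow> c < 4 \<Longrightarrow>
        concurrent L {(j, u a), (j', v b), (3 - j - j', w c)} \<longleftrightarrow> (a, b, c) \<in> square_triples M"
    for j j' u v w
  proof -
    define F where "F m = (if m = 0 then u else if m = 1 then v else (\<lambda>x. w (\<nu> x)))" for m :: nat
    have "reindexing (relabel (perm3 j j') F)"
      by (rule reindexing_relabel[OF bij_perm3]) (simp_all add: F_def that bij_comp)
    moreover have "zero_sum (L \<circ> relabel (perm3 j j') F)"
      unfolding zero_sum_def
    proof (intro allI impI)
      fix a b c :: nat assume abc: "a < 4" "b < 4" "c < 4"
      have "relabel (perm3 j j') F ` transversal a b c = {(j, u a), (j', v b), (3 - j - j', w (\<nu> c))}"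
        by (simp add: relabel_def perm3_def F_def transversal_def)
      then show "concurrent (L \<circ> relabel (perm3 j j') F) (transversal a b c) \<longleftrightarrow> M (M a b) c = 0"
        using abc c[of a b "\<nu> c"] sum_zero_iff[of a b c]
        by (auto simp: concurrent_comp inv_less sq)
    qed
    ultimately show ?thesis by blast
  qed
  have i: "{x, y, z} = {x, z, y}" "{x, y, z} = {y, x, z}" "{x, y, z} = {y, z, x}"
    "{x, y, z} = {z, x, y}" "{x, y, z} = {z, y, x}" for x y z :: "nat \<times> nat"
    by auto
  consider "\<tau> = (\<lambda>(a, b, c). (a, b, c))" | "\<tau> = (\<lambda>(a, b, c). (a, c, b))"
    | "\<tau> = (\<lambda>(a, b, c). (b, a, c))" | "\<tau> = (\<lambda>(a, b, c). (b, c, a))"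
    | "\<tau> = (\<lambda>(a, b, c). (c, a, b))" | "\<tau> = (\<lambda>(a, b, c). (c, b, a))"
    using \<tau> unfolding conjugations_def by blast
  then show ?thesis
  proof cases
    case 1
    have "concurrent L {(0, f a), (1, g b), (3 - 0 - 1, h c)} \<longleftrightarrow> (a, b, c) \<in> square_triples M"
      if "a < 4" "b < 4" "c < 4" for a b c
      using conc[of a b c] that by (auto simp: 1 image_iff sq Bex_def split_paired_Ex)
    then show ?thesis by (intro main_case[of 0 1 f g h]) (simp_all add: fgh)
  next
    case 2
    have "concurrent L {(0, f a), (2, h b), (3 - 0 - 2, g c)} \<longleftrightarrow> (a, b, c) \<in> square_triples M"
      if "a < 4" "b < 4" "c < 4" for a b c
      using conc[of a c b] that i(1)[of "(0, f a)" "(2, h b)" "(1, g c)"]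
      by (auto simp: 2 image_iff sq Bex_def split_paired_Ex)
    then show ?thesis by (intro main_case[of 0 2 f h g]) (simp_all add: fgh)
  next
    case 3
    have "concurrent L {(1, g a), (0, f b), (3 - 1 - 0, h c)} \<longleftrightarrow> (a, b, c) \<in> square_triples M"
      if "a < 4" "b < 4" "c < 4" for a b c
      using conc[of b a c] that i(2)[of "(1, g a)" "(0, f b)" "(2, h c)"]
      by (auto simp: 3 image_iff sq Bex_def split_paired_Ex)
    then show ?thesis by (intro main_case[of 1 0 g f h]) (simp_all add: fgh)
  next
    case 4
    have "concurrent L {(2, h a), (0, f b), (3 - 2 - 0, g c)} \<longleftrightarrow> (a, b, c) \<in> square_triples M"
      if "a < 4" "b < 4" "c < 4" for a b c
      using conc[of b c a] that i(3)[of "(2, h a)" "(0, f b)" "(1, g c)"]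
      by (auto simp: 4 image_iff sq Bex_def split_paired_Ex)
    then show ?thesis by (intro main_case[of 2 0 h f g]) (simp_all add: fgh)
  next
    case 5
    have "concurrent L {(1, g a), (2, h b), (3 - 1 - 2, f c)} \<longleftrightarrow> (a, b, c) \<in> square_triples M"
      if "a < 4" "b < 4" "c < 4" for a b c
      using conc[of c a b] that i(4)[of "(1, g a)" "(2, h b)" "(0, f c)"]
      by (auto simp: 5 image_iff sq Bex_def split_paired_Ex)
    then show ?thesis by (intro main_case[of 1 2 g h f]) (simp_all add: fgh)
  next
    case 6
    have "concurrent L {(2, h a), (1, g b), (3 - 2 - 1, f c)} \<longleftrightarrow> (a, b, c) \<in> square_triples M"
      if "a < 4" "b < 4" "c < 4" for a b c
      using conc[of c b a] that i(5)[of "(2, h a)" "(1, g b)" "(0, f c)"]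
      by (auto simp: 6 image_iff sq Bex_def split_paired_Ex)
    then show ?thesis by (intro main_case[of 2 1 h g f]) (simp_all add: fgh)
  qed
qed

end

text \<open>Isolates the one geometric fact that depends on the group. In both instances
  \<open>e\<^sub>2\<close> is the sum of all four group elements: 2 in the cyclic group and 0 in the
  Klein group.\<close>

locale two_pencil_group = group4 +
  fixes e\<^sub>2 :: nat
  assumes e2: "e\<^sub>2 < 4"
    and third_pencil: "net34 L \<Longrightarrow> zero_sum L \<Longrightarrow> concurrent L (class_minus 0 0) \<Longrightarrow>
      concurrent L (class_minus 1 0) \<Longrightarrow> concurrent L (class_minus 2 e\<^sub>2)"
begin

text \<open>A list of triples depending on \<open>M\<close> and \<open>n\<close> alone, to which
  every arrangement is reduced. The values of \<open>n\<close> that arise are 0, 1 and 3, and the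
  last branch describes 3.\<close>

definition canonical_triples :: "nat \<Rightarrow> (nat \<times> nat) set set" where
  "canonical_triples n =
     {transversal a b c | a b c. a < 4 \<and> b < 4 \<and> c < 4 \<and> M (M a b) c = 0} \<union>
     (if n = 0 then {} else if n = 1 then {class_minus 0 0}
      else {class_minus 0 0, class_minus 1 0, class_minus 2 e\<^sub>2})"

lemma concurrent_triples_zero_sum:
  assumes "net34 L" "zero_sum L"
  shows "concurrent_triples L =
    {transversal a b c | a b c. a < 4 \<and> b < 4 \<and> c < 4 \<and> M (M a b) c = 0} \<union> inner_triples L"
proof -
  have "mixed_triples L = {transversal a b c | a b c. a < 4 \<and> b < 4 \<and> c < 4 \<and> M (M a b) c = 0}"
    using assms(2) unfolding mixed_triples_def zero_sum_def by blast
  then show ?thesis using net34.concurrent_triples_eq[OF assms(1)] by simp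
qed

lemma ex_canonical_inner:
  assumes L: "net34 L" "zero_sum L"
  obtains "num_type_i L = 0" "inner_triples L = {}"
  | \<sigma> where "num_type_i L = 1" "reindexing \<sigma>" "zero_sum (L \<circ> \<sigma>)"
      "inner_triples (L \<circ> \<sigma>) = {class_minus 0 0}"
  | \<sigma> where "num_type_i L = 3" "reindexing \<sigma>" "zero_sum (L \<circ> \<sigma>)"
      "inner_triples (L \<circ> \<sigma>) = {class_minus 0 0, class_minus 1 0, class_minus 2 e\<^sub>2}"
proof -
  have fin: "finite (inner_triples L')" if "net34 L'" for L'
    using finite_concurrent_triples[of L'] net34.concurrent_triples_eq[OF that] by simp
  have num: "card (inner_triples L) = num_type_i L"
    by (rule net34.card_inner_triples[OF L(1)])
  consider "num_type_i L = 0" | "num_type_i L = 1" | "num_type_i L > 1" by linarith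
  then show thesis
  proof cases
    case 1
    then have "inner_triples L = {}" using num fin[OF L(1)] by simp
    with 1 show thesis by (rule that(1))
  next
    case 2
    then obtain S where "inner_triples L = {S}" using num by (auto simp: card_1_singleton_iff)
    then have "S \<in> inner_triples L" by simp
    then obtain j e where je: "j < 3" "e < 4" "concurrent L (class_minus j e)"
      unfolding inner_triples_def by blast
    \<comment> \<open>\<open>ex_symmetry\<close> moves two classes at once; here the second one is
      arbitrary.\<close>
    define j' :: nat where "j' = (if j = 0 then 1 else 0)"
    have "j' < 3" "j \<noteq> j'" by (simp_all add: j'_def)
    then obtain \<sigma> where \<sigma>: "reindexing \<sigma>" "zero_sum (L \<circ> \<sigma>)" "\<sigma> (0, 0) = (j, e)"
      using ex_symmetry[OF L(2), of j j' e 0] je by auto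
    have N: "net34 (L \<circ> \<sigma>)" by (rule net34_comp[OF L(1) \<sigma>(1)])
    have "concurrent (L \<circ> \<sigma>) (class_minus 0 0)"
      using je reindexing_class_minus[OF \<sigma>(1) _ _ \<sigma>(3)] by (simp add: concurrent_comp)
    then have "{class_minus 0 0} \<subseteq> inner_triples (L \<circ> \<sigma>)"
      unfolding inner_triples_def by force
    moreover have "card (inner_triples (L \<circ> \<sigma>)) = 1"
      using net34.card_inner_triples[OF N] num_type_i_comp[OF L(1) \<sigma>(1)] 2 by simp
    ultimately have "inner_triples (L \<circ> \<sigma>) = {class_minus 0 0}"
      by (auto simp: card_1_singleton_iff)
    with 2 \<sigma> show thesis by (intro that(2))
  next
    case 3
    then have "\<not> card {j. j < 3 \<and> type_i L j} \<le> Suc 0" by (simp add: num_type_i_def)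
    then obtain j j' where j: "j < 3" "j' < 3" "j \<noteq> j'" "type_i L j" "type_i L j'"
      by (auto simp: card_le_Suc0_iff_eq)
    then obtain e e' where e: "e < 4" "e' < 4" "concurrent L (class_minus j e)" "concurrent L (class_minus j' e')"
      using type_i_iff by blast
    obtain \<sigma> where \<sigma>: "reindexing \<sigma>" "zero_sum (L \<circ> \<sigma>)" "\<sigma> (0, 0) = (j, e)" "\<sigma> (1, 0) = (j', e')"
      using ex_symmetry[OF L(2)] j e by blast
    have N: "net34 (L \<circ> \<sigma>)" by (rule net34_comp[OF L(1) \<sigma>(1)])
    have "concurrent (L \<circ> \<sigma>) (class_minus 0 0)" "concurrent (L \<circ> \<sigma>) (class_minus 1 0)"
      using e reindexing_class_minus[OF \<sigma>(1) _ _ \<sigma>(3)] reindexing_class_minus[OF \<sigma>(1) _ _ \<sigma>(4)]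
      by (simp_all add: concurrent_comp)
    with third_pencil[OF N \<sigma>(2)]
    have sub: "{class_minus 0 0, class_minus 1 0, class_minus 2 e\<^sub>2} \<subseteq> inner_triples (L \<circ> \<sigma>)"
      unfolding inner_triples_def using e2 by force
    have three: "card {class_minus 0 0, class_minus 1 0, class_minus 2 e\<^sub>2} = 3"
      using e2 by (simp add: class_minus_inject)
    \<comment> \<open>There is at most one inner triple per class, so the three already found are
      all of them.\<close>
    have "num_type_i (L \<circ> \<sigma>) \<le> card {..<3::nat}"
      unfolding num_type_i_def by (rule card_mono) auto
    then have le: "card (inner_triples (L \<circ> \<sigma>)) \<le> 3"
      using net34.card_inner_triples[OF N] by simp
    have eq: "inner_triples (L \<circ> \<sigma>) = {class_minus 0 0, class_minus 1 0, class_minus 2 e\<^sub>2}"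
      using card_seteq[OF fin[OF N] sub] three le by simp
    moreover from this have "num_type_i L = 3"
      using net34.card_inner_triples[OF N] num_type_i_comp[OF L(1) \<sigma>(1)] three by simp
    ultimately show thesis using \<sigma> by (intro that(3))
  qed
qed

lemma ex_canonical_form:
  assumes L: "net34 L" and main: "same_main_class M (latin_entry L)"
  shows "num_type_i L \<in> {0, 1, 3} \<and>
    (\<exists>\<sigma>. reindexing \<sigma> \<and> concurrent_triples (L \<circ> \<sigma>) = canonical_triples (num_type_i L))"
proof -
  obtain \<rho> where \<rho>: "reindexing \<rho>" "zero_sum (L \<circ> \<rho>)"
    using ex_zero_sum_form[OF L main] by blast
  have N: "net34 (L \<circ> \<rho>)" by (rule net34_comp[OF L \<rho>(1)])
  have num: "num_type_i (L \<circ> \<rho>) = num_type_i L" by (rule num_type_i_comp[OF L \<rho>(1)])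
  note triples = concurrent_triples_zero_sum canonical_triples_def
  show ?thesis
  proof (cases rule: ex_canonical_inner[OF N \<rho>(2)])
    case 1
    have "concurrent_triples (L \<circ> \<rho>) = canonical_triples (num_type_i L)"
      using 1 num by (simp add: triples N \<rho>)
    with \<rho> 1 num show ?thesis by auto
  next
    case (2 \<sigma>)
    have "concurrent_triples (L \<circ> \<rho> \<circ> \<sigma>) = canonical_triples (num_type_i L)"
      using 2 num net34_comp[OF N 2(2)] by (simp add: triples)
    with 2 num reindexing_comp[OF \<rho>(1) 2(2)] show ?thesis by (auto simp: comp_assoc)
  next
    case (3 \<sigma>)
    have "concurrent_triples (L \<circ> \<rho> \<circ> \<sigma>) = canonical_triples (num_type_i L)"
      using 3 num net34_comp[OF N 3(2)] by (simp add: triples)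
    with 3 num reindexing_comp[OF \<rho>(1) 3(2)] show ?thesis by (auto simp: comp_assoc)
  qed
qed

text \<open>Both arrangements have the same canonical triples; one relabelling is composed with the
  inverse of the other.\<close>

lemma lattice_isomorphic_if_same_type:
  assumes L: "net34 L" "same_main_class M (latin_entry L)"
    and L': "net34 L'" "same_main_class M (latin_entry L')"
    and num: "num_type_i L = num_type_i L'"
  shows "lattice_isomorphic L L'"
proof -
  obtain \<sigma> \<sigma>' where \<sigma>: "reindexing \<sigma>" "concurrent_triples (L \<circ> \<sigma>) = canonical_triples (num_type_i L)"
    and \<sigma>': "reindexing \<sigma>'" "concurrent_triples (L' \<circ> \<sigma>') = canonical_triples (num_type_i L')"
    using ex_canonical_form[OF L] ex_canonical_form[OF L'] by blast
  let ?\<rho> = "inv_into idx \<sigma>"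
  have \<rho>: "bij_betw ?\<rho> idx idx" by (rule bij_betw_inv_into[OF reindexing_bij[OF \<sigma>(1)]])
  show ?thesis
  proof (rule lattice_isomorphicI[OF L(1) L'(1) bij_betw_trans[OF \<rho> reindexing_bij[OF \<sigma>'(1)]]])
    fix S assume S: "S \<subseteq> idx"
    have sub: "?\<rho> ` S \<subseteq> idx" using S \<rho> by (auto simp: bij_betw_def)
    have "\<sigma> ` ?\<rho> ` S = S"
      using S bij_betw_imp_surj_on[OF reindexing_bij[OF \<sigma>(1)]] by (simp add: image_inv_into_cancel)
    then have "S \<in> concurrent_triples L \<longleftrightarrow> ?\<rho> ` S \<in> concurrent_triples (L \<circ> \<sigma>)"
      using concurrent_triples_comp[OF reindexing_bij[OF \<sigma>(1)] sub] by simp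
    also have "\<dots> \<longleftrightarrow> ?\<rho> ` S \<in> concurrent_triples (L' \<circ> \<sigma>')"
      using \<sigma> \<sigma>' num by simp
    also have "\<dots> \<longleftrightarrow> (\<sigma>' \<circ> ?\<rho>) ` S \<in> concurrent_triples L'"
      using concurrent_triples_comp[OF reindexing_bij[OF \<sigma>'(1)] sub] by (simp add: image_comp)
    finally show "S \<in> concurrent_triples L \<longleftrightarrow> (\<sigma>' \<circ> ?\<rho>) ` S \<in> concurrent_triples L'" .
  qed
qed

end

section \<open>The third pencil for the cyclic and the Klein group\<close>

lemma less_4_cases: "(k::nat) < 4 \<Longrightarrow> k = 0 \<or> k = 1 \<or> k = 2 \<or> k = 3"
  by linarith

lemma class_minus_eq:
  "class_minus j 0 = Pair j ` {1, 2, 3}" "class_minus j 2 = Pair j ` {0, 1, 3}"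
  by (auto simp: class_minus_def dest!: less_4_cases)

context net34
begin

lemma two_pencils_config:
  assumes "concurrent L (class_minus 0 0)" "concurrent L (class_minus 1 0)"
  obtains P Q X where "nonzero X" "dot (L (0, 2)) X = 0" "dot (L (1, 2)) X = 0"
    "\<forall>i\<in>{1,2,3}. dot (L (0, i)) P = 0" "\<forall>i\<in>{1,2,3}. dot (L (1, i)) Q = 0"
    "\<forall>i\<in>{1,2,3}. dot (L (0, i)) Q \<noteq> 0" "\<forall>i\<in>{1,2,3}. dot (L (1, i)) P \<noteq> 0"
    "\<forall>i\<in>{1,3}. dot (L (0, i)) X \<noteq> 0" "\<forall>i\<in>{1,3}. dot (L (1, i)) X \<noteq> 0"
    "dot (L (2, 0)) P \<noteq> 0"
proof -
  obtain P where P: "nonzero P" "\<forall>i\<in>{1,2,3}. dot (L (0, i)) P = 0"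
    using assms(1) unfolding concurrent_iff_dot class_minus_eq by blast
  obtain Q where Q: "nonzero Q" "\<forall>i\<in>{1,2,3}. dot (L (1, i)) Q = 0"
    using assms(2) unfolding concurrent_iff_dot class_minus_eq by blast
  define X where "X = cross (L (0, 2)) (L (1, 2))"
  have X: "nonzero X" unfolding X_def by (rule nonzero_meet) simp_all
  have X': "dot (L (0, 2)) X = 0" "dot (L (1, 2)) X = 0" by (simp_all add: X_def)
  have "\<forall>i\<in>{1,2,3}. dot (L (0, i)) Q \<noteq> 0" "\<forall>i\<in>{1,2,3}. dot (L (1, i)) P \<noteq> 0"
    "dot (L (2, 0)) P \<noteq> 0"
    using same_class_not_mixed[OF Q(1), of 1 1 2] same_class_not_mixed[OF P(1), of 0 1 2] P Q by simp_all
  moreover have "\<forall>i\<in>{1,3}. dot (L (0, i)) X \<noteq> 0"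
    using same_class_not_mixed[OF X, of 0 _ 2 1 2] X' by force
  moreover have "\<forall>i\<in>{1,3}. dot (L (1, i)) X \<noteq> 0"
    using same_class_not_mixed[OF X, of 1 _ 2 0 2] X' by force
  ultimately show thesis using that X X' P(2) Q(2) by blast
qed

end

definition negate :: "nat \<Rightarrow> nat" where
  "negate k = (4 - k) mod 4"

lemma group4_M1: "group4 M1 negate"
  by unfold_locales (auto dest!: less_4_cases simp: M1_def negate_def)

lemma group4_M2: "group4 M2 id"
  by unfold_locales (auto dest!: less_4_cases simp: M2_def)

interpretation M1: two_pencil_group M1 negate 2
proof (intro two_pencil_group.intro two_pencil_group_axioms.intro group4_M1)
  fix L assume "net34 L" and zs: "group4.zero_sum M1 L"
    and c: "concurrent L (class_minus 0 0)" "concurrent L (class_minus 1 0)"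
  interpret net34 L by fact
  have inc: "det3 (L (0, a)) (L (1, b)) (L (2, c)) = 0" if "a < 4" "b < 4" "c < 4" "M1 (M1 a b) c = 0" for a b c
    using zs that concurrent3_iff[of "(0, a)" "(1, b)" "(2, c)"]
    by (simp add: group4.zero_sum_def[OF group4_M1] transversal_def)
  obtain P Q X where cfg: "nonzero X" "dot (L (0, 2)) X = 0" "dot (L (1, 2)) X = 0"
    "\<forall>i\<in>{1,2,3}. dot (L (0, i)) P = 0" "\<forall>i\<in>{1,2,3}. dot (L (1, i)) Q = 0"
    "\<forall>i\<in>{1,2,3}. dot (L (0, i)) Q \<noteq> 0" "\<forall>i\<in>{1,2,3}. dot (L (1, i)) P \<noteq> 0"
    "\<forall>i\<in>{1,3}. dot (L (0, i)) X \<noteq> 0" "\<forall>i\<in>{1,3}. dot (L (1, i)) X \<noteq> 0"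
    "dot (L (2, 0)) P \<noteq> 0"
    by (rule two_pencils_config[OF c])
  have "det3 (L (2, 0)) (L (2, 1)) (L (2, 3)) = 0"
    by (rule two_pencils_cyclic[of X "\<lambda>i. L (0, i)" "\<lambda>i. L (1, i)" P Q "\<lambda>i. L (2, i)", OF cfg(1-9)])
      (rule inc; simp add: M1_def)+
  then have "concurrent L {(2, 0), (2, 1), (2, 3)}" by (simp add: concurrent3_iff)
  then show "concurrent L (class_minus 2 2)" by (simp add: class_minus_eq)
qed simp

interpretation M2: two_pencil_group M2 id 0
proof (intro two_pencil_group.intro two_pencil_group_axioms.intro group4_M2)
  fix L assume "net34 L" and zs: "group4.zero_sum M2 L"
    and c: "concurrent L (class_minus 0 0)" "concurrent L (class_minus 1 0)"
  interpret net34 L by fact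
  have inc: "det3 (L (0, a)) (L (1, b)) (L (2, c)) = 0" if "a < 4" "b < 4" "c < 4" "M2 (M2 a b) c = 0" for a b c
    using zs that concurrent3_iff[of "(0, a)" "(1, b)" "(2, c)"]
    by (simp add: group4.zero_sum_def[OF group4_M2] transversal_def)
  have ne: "det3 (L (0, 1)) (L (0, 3)) (L (1, 1)) \<noteq> 0"
  proof
    assume "det3 (L (0, 1)) (L (0, 3)) (L (1, 1)) = 0"
    then have "concurrent L {(0, 1), (0, 3), (1, 1)}" by (simp add: concurrent3_iff)
    then obtain p where "nonzero p" "dot (L (0, 1)) p = 0" "dot (L (0, 3)) p = 0" "dot (L (1, 1)) p = 0"
      by (auto simp: concurrent_iff_dot)
    then show False using same_class_not_mixed[of p 0 1 3 1 1] by simp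
  qed
  obtain P Q X where cfg: "nonzero X" "dot (L (0, 2)) X = 0" "dot (L (1, 2)) X = 0"
    "\<forall>i\<in>{1,2,3}. dot (L (0, i)) P = 0" "\<forall>i\<in>{1,2,3}. dot (L (1, i)) Q = 0"
    "\<forall>i\<in>{1,2,3}. dot (L (0, i)) Q \<noteq> 0" "\<forall>i\<in>{1,2,3}. dot (L (1, i)) P \<noteq> 0"
    "\<forall>i\<in>{1,3}. dot (L (0, i)) X \<noteq> 0" "\<forall>i\<in>{1,3}. dot (L (1, i)) X \<noteq> 0"
    "dot (L (2, 0)) P \<noteq> 0"
    by (rule two_pencils_config[OF c])
  have "det3 (L (2, 1)) (L (2, 2)) (L (2, 3)) = 0"
    by (rule two_pencils_klein[of X "\<lambda>i. L (0, i)" "\<lambda>i. L (1, i)" P Q "\<lambda>i. L (2, i)", OF cfg ne])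
      (rule inc; simp add: M2_def)+
  then have "concurrent L {(2, 1), (2, 2), (2, 3)}" by (simp add: concurrent3_iff)
  then show "concurrent L (class_minus 2 0)" by (simp add: class_minus_eq)
qed simp

section \<open>Realizations by integer matrices\<close>

type_synonym ivec = "int \<times> int \<times> int"

definition idot :: "ivec \<Rightarrow> ivec \<Rightarrow> int" where
  "idot u p = (case u of (a, b, c) \<Rightarrow> case p of (x, y, z) \<Rightarrow> a * x + b * y + c * z)"

definition icross :: "ivec \<Rightarrow> ivec \<Rightarrow> ivec" where
  "icross u v = (case u of (a, b, c) \<Rightarrow> case v of (x, y, z) \<Rightarrow>
     (b * z - c * y, c * x - a * z, a * y - b * x))"

definition of_ivec :: "ivec \<Rightarrow> cvec" where
  "of_ivec u = (case u of (a, b, c) \<Rightarrow> (of_int a, of_int b, of_int c))"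

lemma dot_of_ivec: "dot (of_ivec u) (of_ivec v) = of_int (idot u v)"
  by (cases u; cases v) (simp add: dot_def idot_def of_ivec_def)

lemma cross_of_ivec: "cross (of_ivec u) (of_ivec v) = of_ivec (icross u v)"
  by (cases u; cases v) (simp add: cross_def icross_def of_ivec_def)

lemma nonzero_of_ivec: "nonzero (of_ivec u) \<longleftrightarrow> u \<noteq> (0, 0, 0)"
  by (cases u) (simp add: nonzero_def of_ivec_def)

definition idx_list :: "(nat \<times> nat) list" where
  "idx_list = List.product [0..<3] [0..<4]"

lemma set_idx_list: "set idx_list = idx"
  by (auto simp: idx_list_def idx_def)

definition entry :: "ivec list list \<Rightarrow> nat \<times> nat \<Rightarrow> ivec" where
  "entry T i = T ! fst i ! snd i"

definition table_lines :: "ivec list list \<Rightarrow> nat \<times> nat \<Rightarrow> cvec" where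
  "table_lines T i = of_ivec (entry T i)"

definition idet :: "ivec list list \<Rightarrow> nat \<times> nat \<Rightarrow> nat \<times> nat \<Rightarrow> nat \<times> nat \<Rightarrow> int" where
  "idet T i i' i'' = idot (entry T i'') (icross (entry T i) (entry T i'))"

text \<open>A finite integer check of everything a net needs: distinct lines, one line of each class
  through every mixed point, no class with four concurrent lines, and the prescribed Latin square.
  In the third clause, four concurrent lines would make both determinants vanish.\<close>

definition valid_table :: "ivec list list \<Rightarrow> (nat \<Rightarrow> nat \<Rightarrow> nat) \<Rightarrow> bool" where
  "valid_table T M \<longleftrightarrow>
     (\<forall>i\<in>set idx_list. \<forall>i'\<in>set idx_list. i \<noteq> i' \<longrightarrow> icross (entry T i) (entry T i') \<noteq> (0, 0, 0)) \<and>
     (\<forall>i\<in>set idx_list. \<forall>i'\<in>set idx_list. fst i \<noteq> fst i' \<longrightarrow>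
        (\<forall>m\<in>set [0,1,2]. length (filter (\<lambda>k. idet T i i' (m, k) = 0) [0,1,2,3]) = 1)) \<and>
     (\<forall>j\<in>set [0,1,2]. idet T (j, 0) (j, 1) (j, 2) = 0 \<longrightarrow> idet T (j, 0) (j, 1) (j, 3) \<noteq> 0) \<and>
     (\<forall>a\<in>set [0,1,2,3]. \<forall>b\<in>set [0,1,2,3]. idet T (0, a) (1, b) (2, M a b) = 0)"

definition pencil_classes :: "ivec list list \<Rightarrow> nat list" where
  "pencil_classes T = filter (\<lambda>j. \<exists>(a, b, c) \<in> set [(1,2,3), (0,2,3), (0,1,3), (0,1,2)].
     idet T (j, a) (j, b) (j, c) = 0) [0,1,2]"

lemma ex1_if_filter_length:
  assumes "length (filter P [0, 1, 2, 3]) = 1"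
  shows "\<exists>!k::nat. k < 4 \<and> P k"
proof -
  obtain k where k: "filter P [0, 1, 2, 3] = [k]"
    using assms by (auto simp only: length_Suc_conv One_nat_def length_0_conv)
  have mem: "l < 4 \<and> P l \<longleftrightarrow> l \<in> set (filter P [0, 1, 2, 3])" for l
    by (auto dest: less_4_cases)
  show ?thesis unfolding mem k by simp
qed

lemma proportional_imp_cross_zero: "proportional u v \<Longrightarrow> \<not> nonzero (cross u v)"
  by (cases u) (auto simp: proportional_def smul_def nonzero_def cross_def)

context
  fixes T :: "ivec list list" and M :: "nat \<Rightarrow> nat \<Rightarrow> nat"
  assumes valid: "valid_table T M"
begin

lemma nonzero_cross_table:
  "i \<in> idx \<Longrightarrow> i' \<in> idx \<Longrightarrow> i \<noteq> i' \<Longrightarrow> nonzero (cross (table_lines T i) (table_lines T i'))"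
  unfolding table_lines_def cross_of_ivec nonzero_of_ivec
  using valid unfolding valid_table_def set_idx_list by blast

text \<open>The common points of two lines are the nonzero multiples of their integer cross product.
  This reduces statements about all complex points to integer determinants.\<close>

lemma dot_table:
  assumes "i \<in> idx" "i' \<in> idx" "i \<noteq> i'" "nonzero p"
    and "dot (table_lines T i) p = 0" "dot (table_lines T i') p = 0"
  shows "dot (table_lines T i'') p = 0 \<longleftrightarrow> idet T i i' i'' = 0"
proof -
  have "proportional (cross (table_lines T i) (table_lines T i')) p"
    using proportional_cross[OF nonzero_cross_table] assms by blast
  from proportional_dot[OF this, of "table_lines T i''"] show ?thesis
    by (simp add: table_lines_def cross_of_ivec dot_of_ivec idet_def)
qed

lemma ex1_table:
  assumes "i \<in> idx" "i' \<in> idx" "fst i \<noteq> fst i'" "nonzero p"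
    and "dot (table_lines T i) p = 0" "dot (table_lines T i') p = 0" "m < 3"
  shows "\<exists>!k. k < 4 \<and> dot (table_lines T (m, k)) p = 0"
proof -
  have "m \<in> set [0, 1, 2]" using assms(7) by auto
  then have "length (filter (\<lambda>k. idet T i i' (m, k) = 0) [0,1,2,3]) = 1"
    using valid assms(1-3) unfolding valid_table_def set_idx_list by blast
  then have "\<exists>!k. k < 4 \<and> idet T i i' (m, k) = 0" by (rule ex1_if_filter_length)
  moreover have "i \<noteq> i'" using assms(3) by blast
  ultimately show ?thesis unfolding dot_table[OF assms(1,2) \<open>i \<noteq> i'\<close> assms(4-6)] by simp
qed

lemma net34_table: "net34 (table_lines T)"
proof
  show "is_34_net (table_lines T)"
    unfolding is_34_net_def incident_iff_dot
  proof (intro conjI ballI impI allI)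
    fix i assume i: "i \<in> idx"
    define i' where "i' = (if i = (0, 0) then (0, 1) else (0, 0) :: nat \<times> nat)"
    have "nonzero (cross (table_lines T i) (table_lines T i'))"
      using i by (intro nonzero_cross_table) (auto simp: i'_def)
    then show "nonzero (table_lines T i)"
      by (cases "table_lines T i'") (auto simp: nonzero_def cross_def)
  next
    fix i i' assume "i \<in> idx" "i' \<in> idx" "i \<noteq> i'"
    then show "\<not> proportional (table_lines T i) (table_lines T i')"
      using nonzero_cross_table proportional_imp_cross_zero by blast
  next
    fix p j k j' k' and m :: nat
    assume "nonzero p" "m < 3" "(j, k) \<in> idx \<and> (j', k') \<in> idx \<and> j \<noteq> j' \<and>
      dot (table_lines T (j, k)) p = 0 \<and> dot (table_lines T (j', k')) p = 0"
    then show "\<exists>!k. k < 4 \<and> dot (table_lines T (m, k)) p = 0"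
      by (intro ex1_table[of "(j, k)" "(j', k')"]) auto
  qed
  \<comment> \<open>At a mixed point there is one line per class. Otherwise four lines would be a
    whole class, which the third clause of \<open>valid_table\<close> forbids.\<close>
  have le3: "card (lines_through (table_lines T) p) \<le> 3" if p: "nonzero p" for p
  proof (cases "\<exists>i\<in>lines_through (table_lines T) p. \<exists>i'\<in>lines_through (table_lines T) p. fst i \<noteq> fst i'")
    case True
    then obtain i i' where i: "i \<in> idx" "i' \<in> idx" "fst i \<noteq> fst i'"
      "dot (table_lines T i) p = 0" "dot (table_lines T i') p = 0"
      using in_lines_through by blast
    have "inj_on fst (lines_through (table_lines T) p)"
    proof (rule inj_onI)
      fix x y assume xy: "x \<in> lines_through (table_lines T) p" "y \<in> lines_through (table_lines T) p" "fst x = fst y"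
      obtain m k k' where eq: "x = (m, k)" "y = (m, k')" using xy(3) by (cases x; cases y) auto
      have "m < 3" using xy(1) by (simp add: eq in_lines_through)
      from ex1_table[OF i(1-3) p i(4,5) this] show "x = y"
        using xy(1,2) unfolding eq in_lines_through in_idx by blast
    qed
    moreover have "fst ` lines_through (table_lines T) p \<subseteq> {..<3}"
      by (auto simp: in_lines_through)
    ultimately show ?thesis using card_inj_on_le[of fst _ "{..<3::nat}"] by simp
  next
    case False
    show ?thesis
    proof (rule ccontr)
      assume "\<not> ?thesis"
      then have four: "card (lines_through (table_lines T) p) \<ge> 4" by simp
      then obtain i where i: "i \<in> lines_through (table_lines T) p" by fastforce
      define j where "j = fst i"
      have j: "j < 3" using i by (cases i) (auto simp: j_def in_lines_through)
      have "lines_through (table_lines T) p \<subseteq> {j} \<times> {..<4}"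
      proof
        fix x assume x: "x \<in> lines_through (table_lines T) p"
        then have "fst x = j" using False i unfolding j_def by blast
        then show "x \<in> {j} \<times> {..<4}" using x by (cases x) (auto simp: in_lines_through)
      qed
      then have "lines_through (table_lines T) p = {j} \<times> {..<4}"
        using four by (intro card_seteq) (simp_all add: card_cartesian_product_singleton)
      then have l: "dot (table_lines T (j, k)) p = 0" if "k < 4" for k
        using that unfolding set_eq_iff in_lines_through by blast
      have "idet T (j, 0) (j, 1) (j, k) = 0" if "k < 4" for k
        using dot_table[of "(j, 0)" "(j, 1)" p "(j, k)"] l that j p by simp
      moreover have "j \<in> set [0, 1, 2]" using j by auto
      then have "idet T (j, 0) (j, 1) (j, 2) = 0 \<longrightarrow> idet T (j, 0) (j, 1) (j, 3) \<noteq> 0"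
        using valid unfolding valid_table_def by blast
      ultimately show False by simp
    qed
  qed
  show "only_double_triple (table_lines T)"
    unfolding only_double_triple_def
  proof (intro allI impI)
    fix p assume "nonzero p" "card (lines_through (table_lines T) p) \<ge> 2"
    then show "card (lines_through (table_lines T) p) = 2 \<or> card (lines_through (table_lines T) p) = 3"
      using le3[of p] by linarith
  qed
qed

interpretation table: net34 "table_lines T"
  by (rule net34_table)

lemma concurrent_table:
  assumes "i \<in> idx" "i' \<in> idx" "i \<noteq> i'"
  shows "concurrent (table_lines T) {i, i', i''} \<longleftrightarrow> idet T i i' i'' = 0"
  using table.concurrent3_iff[OF assms]
  by (simp add: det3_def table_lines_def cross_of_ivec dot_of_ivec idet_def)

lemma latin_entry_table:
  assumes "a < 4" "b < 4" "M a b < 4"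
  shows "latin_entry (table_lines T) a b = M a b"
proof -
  have "a \<in> set [0,1,2,3]" "b \<in> set [0,1,2,3]" using assms by auto
  then have "idet T (0, a) (1, b) (2, M a b) = 0"
    using valid unfolding valid_table_def by blast
  then have "concurrent (table_lines T) (transversal a b (M a b))"
    using concurrent_table assms by (simp add: transversal_def)
  then show ?thesis
    using table.latin_entry_eq[OF assms] by (simp add: square_triples_def)
qed

lemma same_main_class_table:
  assumes "\<And>a b. a < 4 \<Longrightarrow> b < 4 \<Longrightarrow> M a b < 4"
  shows "same_main_class M (latin_entry (table_lines T))"
  unfolding same_main_class_def
proof (rule exI[of _ id], rule exI[of _ id], rule exI[of _ id],
    rule exI[of _ "\<lambda>(a, b, c). (a, b, c)"], intro conjI bij_betw_id)
  show "(\<lambda>(a, b, c). (a, b, c)) \<in> conjugations" by (simp add: conjugations_def)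
  show "square_triples (latin_entry (table_lines T)) =
    (\<lambda>(a, b, c). (id a, id b, id c)) ` (\<lambda>(a, b, c). (a, b, c)) ` square_triples M"
    using latin_entry_table assms by (force simp: square_triples_def image_iff split_paired_Ex Bex_def)
qed

lemma num_type_i_table: "num_type_i (table_lines T) = length (pencil_classes T)"
proof -
  have cm: "class_minus j 0 = {(j, 1), (j, 2), (j, 3)}" "class_minus j 1 = {(j, 0), (j, 2), (j, 3)}"
    "class_minus j 2 = {(j, 0), (j, 1), (j, 3)}" "class_minus j 3 = {(j, 0), (j, 1), (j, 2)}" for j
    by (auto simp: class_minus_def dest!: less_4_cases)
  have ex4: "(\<exists>e<4. Q e) \<longleftrightarrow> Q 0 \<or> Q 1 \<or> Q 2 \<or> Q 3" for Q :: "nat \<Rightarrow> bool"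
  proof
    assume "Q 0 \<or> Q 1 \<or> Q 2 \<or> Q 3"
    moreover have "(0::nat) < 4" "(1::nat) < 4" "(2::nat) < 4" "(3::nat) < 4" by simp_all
    ultimately show "\<exists>e<4. Q e" by blast
  qed (auto dest!: less_4_cases)
  have "type_i (table_lines T) j \<longleftrightarrow> (\<exists>(a, b, c) \<in> set [(1,2,3), (0,2,3), (0,1,3), (0,1,2)].
     idet T (j, a) (j, b) (j, c) = 0)" if "j < 3" for j
    using that by (simp add: type_i_iff ex4 cm concurrent_table del: One_nat_def)
  then have "{j. j < 3 \<and> type_i (table_lines T) j} = set (pencil_classes T)"
    unfolding pencil_classes_def set_filter by (auto dest: less_3_cases)
  moreover have "distinct (pencil_classes T)"
    by (simp add: pencil_classes_def)
  ultimately show ?thesis by (simp add: num_type_i_def distinct_card)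
qed

lemma good_arr_table:
  assumes "\<And>a b. a < 4 \<Longrightarrow> b < 4 \<Longrightarrow> M a b < 4" "pencil_classes T = js"
  shows "good_arr (table_lines T) M" "num_type_i (table_lines T) = length js"
    "num_triple_points (table_lines T) = 16 + length js"
  using same_main_class_table[OF assms(1)] num_type_i_table assms(2) table.net table.double_triple
    table.num_triple_points_eq table.card_concurrent_triples
  by (simp_all add: good_arr_def)

end

text \<open>
  For no or one class of type (i), the three classes are dual to cosets with sum zero of a rational
  subgroup of order 4 of an elliptic curve. With three, they complete a 3 by 3 grid: for \<open>M1\<close> the
  grid lines are \<open>x, y \<in> {-2, 0, 1}\<close>, and for \<open>M2\<close> they are the same, with the fourth lines
  \<open>x + 2y + 1 = 0\<close> and \<open>2x + y + 1 = 0\<close>.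
\<close>
definition table_M1_0 :: "ivec list list" where
  "table_M1_0 =
  [[(-6, -4, 3), (21, -98, 27), (14, 49, 1), (-14, 7, 24)],
   [(-1, -2, 1), (14, -49, 3), (42, 49, 24), (-42, 28, 27)],
   [(12, -80, 27), (-420, -175, 192), (-140, 49, 375), (35, 196, 1)]]"

definition table_M1_1 :: "ivec list list" where
  "table_M1_1 =
  [[(-2, 1, 2), (-6, -9, 8), (3, -9, 1), (3, 3, 2)],
   [(-1, -1, 1), (3, -9, 2), (6, 9, 2), (-6, 3, 8)],
   [(0, 1, 0), (0, -3, 2), (-3, 0, 2), (0, 0, 1)]]"

definition table_M1_3 :: "ivec list list" where
  "table_M1_3 =
  [[(-2, 5, -2), (1, 0, 2), (1, 0, 0), (1, 0, -1)],
   [(5, -2, -2), (0, 1, -1), (0, 1, 0), (0, 1, 2)],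
   [(1, -1, 0), (-2, 1, 2), (1, 1, 1), (1, -2, 2)]]"

definition table_M2_0 :: "ivec list list" where
  "table_M2_0 =
  [[(-6, 6, 1), (-4, -4, 1), (12, -60, 1), (2, 10, 1)],
   [(1, -6, 1), (24, 144, 1), (-96, 80, 27), (-54, -45, 8)],
   [(-1050, 330, 343), (-980, -308, 125), (132, -2100, 1331), (242, 3850, 1)]]"

definition table_M2_1 :: "ivec list list" where
  "table_M2_1 =
  [[(-2, 0, 1), (3, 0, 1), (0, 1, 0), (0, 0, 1)],
   [(-1, 2, 1), (6, 12, 1), (8, -20, 1), (-6, -15, 8)],
   [(8, 20, 1), (-6, 15, 8), (-1, -2, 1), (6, -12, 1)]]"

definition table_M2_3 :: "ivec list list" where
  "table_M2_3 =
  [[(1, 2, 1), (1, 0, 2), (1, 0, 0), (1, 0, -1)],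
   [(2, 1, 1), (0, 1, 2), (0, 1, 0), (0, 1, -1)],
   [(1, -1, 0), (1, 1, -1), (1, 1, 1), (1, 1, 2)]]"

lemma table_M1_0: "valid_table table_M1_0 M1" "pencil_classes table_M1_0 = []"
  by code_simp+

lemma table_M1_1: "valid_table table_M1_1 M1" "pencil_classes table_M1_1 = [2]"
  by code_simp+

lemma table_M1_3: "valid_table table_M1_3 M1" "pencil_classes table_M1_3 = [0, 1, 2]"
  by code_simp+

lemma table_M2_0: "valid_table table_M2_0 M2" "pencil_classes table_M2_0 = []"
  by code_simp+

lemma table_M2_1: "valid_table table_M2_1 M2" "pencil_classes table_M2_1 = [0]"
  by code_simp+

lemma table_M2_3: "valid_table table_M2_3 M2" "pencil_classes table_M2_3 = [0, 1, 2]"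
  by code_simp+

section \<open>The classification by the number of triple points\<close>

lemma good_arr_net34: "good_arr L M \<Longrightarrow> net34 L"
  by (simp add: good_arr_def net34_def)

lemma num_triple_points_num_type_i:
  "good_arr L M \<Longrightarrow> num_triple_points L = 16 + num_type_i L"
  using net34.num_triple_points_eq net34.card_concurrent_triples good_arr_net34 by simp

lemma num_type_i_cases:
  assumes "M \<in> {M1, M2}" "good_arr L M"
  shows "num_type_i L \<in> {0, 1, 3}"
  using M1.ex_canonical_form[OF good_arr_net34[OF assms(2)]]
    M2.ex_canonical_form[OF good_arr_net34[OF assms(2)]] assms
  unfolding good_arr_def by blast

lemma ex_good_arr:
  assumes "M \<in> {M1, M2}" "n \<in> {0, 1, 3}"
  shows "\<exists>L. good_arr L M \<and> num_type_i L = n \<and> num_triple_points L = 16 + n"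
proof -
  note M1_tables = good_arr_table[OF table_M1_0(1) M1.closed table_M1_0(2)]
    good_arr_table[OF table_M1_1(1) M1.closed table_M1_1(2)]
    good_arr_table[OF table_M1_3(1) M1.closed table_M1_3(2)]
  note M2_tables = good_arr_table[OF table_M2_0(1) M2.closed table_M2_0(2)]
    good_arr_table[OF table_M2_1(1) M2.closed table_M2_1(2)]
    good_arr_table[OF table_M2_3(1) M2.closed table_M2_3(2)]
  consider "M = M1" "n = 0" | "M = M1" "n = 1" | "M = M1" "n = 3"
    | "M = M2" "n = 0" | "M = M2" "n = 1" | "M = M2" "n = 3" using assms by blast
  then show ?thesis
  proof cases
    case 1 then show ?thesis using M1_tables(1-3) by (intro exI[of _ "table_lines table_M1_0"]) simp
  next
    case 2 then show ?thesis using M1_tables(4-6) by (intro exI[of _ "table_lines table_M1_1"]) simp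
  next
    case 3 then show ?thesis using M1_tables(7-9) by (intro exI[of _ "table_lines table_M1_3"]) simp
  next
    case 4 then show ?thesis using M2_tables(1-3) by (intro exI[of _ "table_lines table_M2_0"]) simp
  next
    case 5 then show ?thesis using M2_tables(4-6) by (intro exI[of _ "table_lines table_M2_1"]) simp
  next
    case 6 then show ?thesis using M2_tables(7-9) by (intro exI[of _ "table_lines table_M2_3"]) simp
  qed
qed

theorem theorem2p5:
  shows
   "(\<forall>L M. M \<in> {M1, M2} \<and> good_arr L M \<longrightarrow>
        (num_type_i L = 0 \<and> num_triple_points L = 16) \<or>
        (num_type_i L = 3 \<and> num_triple_points L = 19) \<or>
        (num_type_i L = 1 \<and> num_triple_points L = 17))
    \<and> (\<forall>M \<in> {M1, M2}. \<forall>(n, t) \<in> {(0, 16), (3, 19), (1, 17)}.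
        \<exists>L. good_arr L M \<and> num_type_i L = n \<and> num_triple_points L = t)
    \<and> (\<forall>L L' M. M \<in> {M1, M2} \<and> good_arr L M \<and> good_arr L' M \<and>
        num_triple_points L = num_triple_points L' \<longrightarrow> lattice_isomorphic L L')"
proof (intro conjI allI impI)
  fix L M assume *: "M \<in> {M1, M2} \<and> good_arr L M"
  then show "(num_type_i L = 0 \<and> num_triple_points L = 16) \<or>
        (num_type_i L = 3 \<and> num_triple_points L = 19) \<or>
        (num_type_i L = 1 \<and> num_triple_points L = 17)"
    using num_type_i_cases[of M L] num_triple_points_num_type_i[of L M] by auto
next
  show "\<forall>M \<in> {M1, M2}. \<forall>(n, t) \<in> {(0, 16), (3, 19), (1, 17)}.
        \<exists>L. good_arr L M \<and> num_type_i L = n \<and> num_triple_points L = t"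
  proof
    fix M assume M: "M \<in> {M1, M2}"
    show "\<forall>(n, t) \<in> {(0, 16), (3, 19), (1, 17)}.
        \<exists>L. good_arr L M \<and> num_type_i L = n \<and> num_triple_points L = t"
      using ex_good_arr[OF M, of 0] ex_good_arr[OF M, of 1] ex_good_arr[OF M, of 3] by simp
  qed
next
  fix L L' M
  assume *: "M \<in> {M1, M2} \<and> good_arr L M \<and> good_arr L' M \<and>
        num_triple_points L = num_triple_points L'"
  then have "num_type_i L = num_type_i L'"
    using num_triple_points_num_type_i[of L M] num_triple_points_num_type_i[of L' M] by simp
  moreover have "net34 L" "net34 L'" using * good_arr_net34 by blast+
  ultimately show "lattice_isomorphic L L'"
    using * M1.lattice_isomorphic_if_same_type M2.lattice_isomorphic_if_same_type
    by (auto simp: good_arr_def)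
qed

end
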